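(* Let $\{\hat x_t\}$ be the average iterates produced by the averaged decision-dependent proximal stochastic gradient method with constant step size $\eta_t\equiv\eta$, $0<\eta\le1/(2L)$, and set $\hat\rho:=\hat\mu\eta/(2-\mu\eta)$. Suppose that the regularizers $r_t\equiv r$ are identical for all $t$ and that there exist constants $\bar\Delta,\sigma>0$ such that for all $0\le i<t$: (i) $\mathbb{E}\,\bar G_{i,t}^2\le(\hat\mu\bar\Delta|i-t|)^2$; (ii) $\mathbb{E}\|z_i\|^2\le\sigma^2$ and $\mathbb{E}\langle z_i,\bar x_t\rangle=0$. Then $$\mathbb{E}\left[\psi_t(\hat x_t)-\psi_t^\star\right]\le(1-\hat\rho)^t\,\mathbb{E}\left[\psi_t(x_0)-\psi_t^\star+\tfrac{\hat\mu}{4}\|x_0-\bar x_t\|^2\right]+\eta\sigma^2+\frac{8\bar\Delta^2}{\hat\mu\eta^2}$$ for all $t\ge0$. Consequently, $$\mathbb{E}\left[\psi_t(\hat x_t)-\psi_t^\star\right]\lesssim(1-\hat\rho)^t\left(\psi_0(x_0)-\psi_0^\star\right)+\eta\sigma^2+\frac{\bar\Delta^2}{\hat\mu\eta^2}$$ for all $t\ge0$, and the following asymptotic error bound holds: $$\limsup_{t\to\infty}\mathbb{E}\left[\psi_t(\hat x_t)-\psi_t^\star\right]\le\eta\sigma^2+\frac{8\bar\Delta^2}{\hat\mu\eta^2}.$$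
   Context: Notation: $\mathbb{N}=\{0,1,2,\dots\}$; $\mathbb{R}^d$ carries the Euclidean inner product $\langle\cdot,\cdot\rangle$ and norm $\|\cdot\|$; $A\lesssim B$ means $A\le CB$ for an absolute numerical constant $C>0$ independent of all problem parameters. Problem family. For each $t\in\mathbb{N}$ and $x\in\mathbb{R}^d$, $f_{t,x}\colon\mathbb{R}^d\to\mathbb{R}$ is $\mu$-strongly convex and $C^1$-smooth with $L$-Lipschitz gradient, for common constants $\mu,L>0$; $\nabla f_{t,x}(u)$ denotes the gradient of $f_{t,x}(\cdot)$ at $u$. For each $t$, $r_t\colon\mathbb{R}^d\to\mathbb{R}\cup\{\infty\}$ is proper, closed, convex. Set $$\gamma:=\sup_{t\in\mathbb{N},\,u,x,y\in\mathbb{R}^d,\,x\ne y}\frac{\|\nabla f_{t,x}(u)-\nabla f_{t,y}(u)\|}{\|x-y\|},$$ and assume $\gamma<\mu/2$. Set $\bar\mu:=\mu-\gamma$ and $\hat\mu:=\mu-2\gamma>0$. The functions may be random (the problem may evolve stochastically), with these conditions holding for every outcome with deterministic $\mu,L,\gamma$. The temporal gradient drift is the random variable $\bar G_{i,t}:=\sup_{u,x\in\mathbb{R}^d}\|\nabla f_{i,x}(u)-\nabla f_{t,x}(u)\|$. Equilibria. For each $t$ there is a unique point $\bar x_t$ with $\bar x_t\in\operatorname{argmin}_{u\in\mathbb{R}^d}\{f_{t,\bar x_t}(u)+r_t(u)\}$. Set $\psi_t:=f_{t,\bar x_t}+r_t$ and $\psi_t^\star:=\min\psi_t=\psi_t(\bar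 x_t)$. Algorithm (averaged decision-dependent proximal stochastic gradient method). Given $x_0=\hat x_0$ and step sizes $\eta_t\in(0,1/\bar\mu)$, at each step $t\ge0$ a stochastic gradient $g_t$ (estimator of $\nabla f_{t,x_t}(x_t)$) is obtained and $$x_{t+1}=\operatorname{prox}_{\eta_t r_t}(x_t-\eta_t g_t)=\operatorname{argmin}_{u}\left\{r_t(u)+\tfrac{1}{2\eta_t}\|u-(x_t-\eta_t g_t)\|^2\right\},\qquad \hat x_{t+1}=\left(1-\tfrac{\hat\mu\eta_t}{2-\mu\eta_t}\right)\hat x_t+\tfrac{\hat\mu\eta_t}{2-\mu\eta_t}x_{t+1}.$$ The gradient noise is $z_t:=\nabla f_{t,x_t}(x_t)-g_t$. Stochastic framework. There is a probability space $(\Omega,\mathcal{F},\mathbb{P})$ with filtration $(\mathcal{F}_t)_{t\ge0}$, $\mathcal{F}_0=\{\emptyset,\Omega\}$, such that for all $t\ge0$: $x_t,\bar x_t\colon\Omega\to\mathbb{R}^d$ are $\mathcal{F}_t$-measurable, and $z_t\colon\Omega\to\mathbb{R}^d$ is $\mathcal{F}_{t+1}$-measurable with $\mathbb{E}[z_t\mid\mathcal{F}_t]=0$. Consistently with $\mathcal{F}_0$ being trivial, the initial gap $\psi_0(x_0)-\psi_0^\star$ is deterministic. All quantities whose expectations are taken are understood to be random variables.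
   Formalization: The limsup bound is stated under the extra assumption that the initial gap ψ_0(x_0) − ψ_0^⋆ is finite (x_0 in the domain of r); without it the bound can fail, since all averages may stay outside the domain of r. *)

theory Defs
  imports "HOL-Probability.Probability"
begin

section \<open>Convex analysis\<close>

definition grad :: "('e::euclidean_space \<Rightarrow> real) \<Rightarrow> 'e \<Rightarrow> 'e" where
  "grad f u = (THE D. GDERIV f u :> D)"

definition strongly_convex :: "real \<Rightarrow> ('e::euclidean_space \<Rightarrow> real) \<Rightarrow> bool" where
  "strongly_convex m f \<longleftrightarrow> convex_on UNIV (\<lambda>u. f u - m / 2 * (norm u)\<^sup>2)"

definition lipschitz_smooth :: "real \<Rightarrow> ('e::euclidean_space \<Rightarrow> real) \<Rightarrow> bool" where
  "lipschitz_smooth L f \<longleftrightarrow> (\<forall>u. f differentiable (at u)) \<and> L-lipschitz_on UNIV (grad f)"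

text \<open>The library's epigraph is for real-valued functions only.\<close>

definition epi :: "('e::euclidean_space \<Rightarrow> ereal) \<Rightarrow> ('e \<times> real) set" where
  "epi h = {(u, a). h u \<le> ereal a}"

definition proper_closed_convex :: "('e::euclidean_space \<Rightarrow> ereal) \<Rightarrow> bool" where
  "proper_closed_convex h \<longleftrightarrow>
     (\<forall>u. h u \<noteq> -\<infinity>) \<and> (\<exists>u. h u \<noteq> \<infinity>) \<and> closed (epi h) \<and> convex (epi h)"

definition is_minimizer :: "('e \<Rightarrow> ereal) \<Rightarrow> 'e \<Rightarrow> bool" where
  "is_minimizer h u \<longleftrightarrow> is_arg_min h (\<lambda>_. True) u"

text \<open>For proper closed convex \<open>h\<close> the proximal point exists and is unique, so this relation
  is the graph of the proximal map.\<close>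

definition is_prox :: "real \<Rightarrow> ('e::euclidean_space \<Rightarrow> ereal) \<Rightarrow> 'e \<Rightarrow> 'e \<Rightarrow> bool" where
  "is_prox \<eta> h v p \<longleftrightarrow>
     is_minimizer (\<lambda>u. h u + ereal (1 / (2 * \<eta>) * (norm (u - v))\<^sup>2)) p"


section \<open>Expectations\<close>

text \<open>Expectation of a nonnegative extended-real random variable; the value \<open>\<infinity>\<close> is possible.
  Negative values of \<open>Y\<close> would be cut off, so this is to be used for nonnegative \<open>Y\<close> only.\<close>

definition expect :: "'w measure \<Rightarrow> ('w \<Rightarrow> ereal) \<Rightarrow> ereal" where
  "expect M Y = enn2ereal (\<integral>\<^sup>+\<omega>. e2ennreal (Y \<omega>) \<partial>M)"

definition vec_cond_exp ::
  "'w measure \<Rightarrow> 'w measure \<Rightarrow> ('w \<Rightarrow> 'e::euclidean_space) \<Rightarrow> 'w \<Rightarrow> 'e" where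
  "vec_cond_exp M G Z = (\<lambda>\<omega>. \<Sum>b\<in>Basis. real_cond_exp M G (\<lambda>\<omega>'. Z \<omega>' \<bullet> b) \<omega> *\<^sub>R b)"


section \<open>Problem family, equilibria, algorithm\<close>

text \<open>The value \<open>f t \<omega> x u\<close> is $f_{t,x}(u)$ at the outcome \<open>\<omega>\<close>: the decision \<open>x\<close>
  parametrizes the function, \<open>u\<close> is its argument, and gradients are taken in \<open>u\<close>.\<close>

type_synonym ('w, 'e) loss = "nat \<Rightarrow> 'w \<Rightarrow> 'e \<Rightarrow> 'e \<Rightarrow> real"
type_synonym ('w, 'e) regularizer = "nat \<Rightarrow> 'w \<Rightarrow> 'e \<Rightarrow> ereal"

text \<open>The supremum also runs over the outcomes, since \<open>\<gamma>\<close> is deterministic. If the supremum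
  at each single outcome is \<open>\<gamma>\<close>, then so is this one.\<close>

definition sensitivity :: "'w measure \<Rightarrow> ('w, 'e::euclidean_space) loss \<Rightarrow> ereal" where
  "sensitivity M f =
     (SUP (\<omega>, t, u, x, y) \<in> {(\<omega>, t, u, x, y). \<omega> \<in> space M \<and> x \<noteq> y}.
        ereal (norm (grad (f t \<omega> x) u - grad (f t \<omega> y) u) / norm (x - y)))"

definition grad_drift :: "('w, 'e::euclidean_space) loss \<Rightarrow> nat \<Rightarrow> nat \<Rightarrow> 'w \<Rightarrow> ereal" where
  "grad_drift f i t \<omega> = (SUP (u, x). ereal (norm (grad (f i \<omega> x) u - grad (f t \<omega> x) u)))"

locale problem_family =
  fixes M :: "'w measure" and f :: "('w, 'e::euclidean_space) loss"
    and r :: "('w, 'e) regularizer" and \<mu> L \<gamma> :: real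
  assumes mu_pos: "\<mu> > 0" and L_pos: "L > 0"
    and f_strongly_convex: "\<And>t \<omega> x. \<omega> \<in> space M \<Longrightarrow> strongly_convex \<mu> (f t \<omega> x)"
    and f_smooth: "\<And>t \<omega> x. \<omega> \<in> space M \<Longrightarrow> lipschitz_smooth L (f t \<omega> x)"
    and r_proper_closed_convex: "\<And>t \<omega>. \<omega> \<in> space M \<Longrightarrow> proper_closed_convex (r t \<omega>)"
    and gamma_eq: "sensitivity M f = ereal \<gamma>"
    and gamma_less: "\<gamma> < \<mu> / 2"

text \<open>In \<open>psi\<close> and \<open>gap\<close> the argument \<open>v\<close> is the point whose decision-induced loss is used; it
  will always be the equilibrium at time \<open>t\<close>, so that \<open>psi\<close> is $\psi_t = f_{t,\bar x_t} + r_t$ and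
  \<open>gap\<close> is $\psi_t(u) - \psi_t^\star$.\<close>

definition psi :: "('w, 'e::euclidean_space) loss \<Rightarrow> ('w, 'e) regularizer \<Rightarrow>
    nat \<Rightarrow> 'w \<Rightarrow> 'e \<Rightarrow> 'e \<Rightarrow> ereal" where
  "psi f r t \<omega> v u = ereal (f t \<omega> v u) + r t \<omega> u"

definition gap :: "('w, 'e::euclidean_space) loss \<Rightarrow> ('w, 'e) regularizer \<Rightarrow>
    (nat \<Rightarrow> 'w \<Rightarrow> 'e) \<Rightarrow> nat \<Rightarrow> 'w \<Rightarrow> 'e \<Rightarrow> ereal" where
  "gap f r xbar t \<omega> u = psi f r t \<omega> (xbar t \<omega>) u - (INF v. psi f r t \<omega> (xbar t \<omega>) v)"

definition equilibria :: "'w measure \<Rightarrow> ('w, 'e::euclidean_space) loss \<Rightarrow> ('w, 'e) regularizer \<Rightarrow>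
    (nat \<Rightarrow> 'w \<Rightarrow> 'e) \<Rightarrow> bool" where
  "equilibria M f r xbar \<longleftrightarrow>
     (\<forall>t. \<forall>\<omega>\<in>space M. is_minimizer (psi f r t \<omega> (xbar t \<omega>)) (xbar t \<omega>))"

text \<open>The stochastic gradient is $g_t = \nabla f_{t,x_t}(x_t) - z_t$.\<close>

locale averaged_prox_sgd =
  fixes M :: "'w measure" and f :: "('w, 'e::euclidean_space) loss"
    and r :: "('w, 'e) regularizer" and \<mu> \<gamma> :: real and \<eta> :: "nat \<Rightarrow> real"
    and x xhat z :: "nat \<Rightarrow> 'w \<Rightarrow> 'e"
  assumes step_size: "\<And>t. 0 < \<eta> t \<and> \<eta> t < 1 / (\<mu> - \<gamma>)"
    and xhat_0: "\<And>\<omega>. \<omega> \<in> space M \<Longrightarrow> xhat 0 \<omega> = x 0 \<omega>"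
    and x_Suc: "\<And>t \<omega>. \<omega> \<in> space M \<Longrightarrow>
      is_prox (\<eta> t) (r t \<omega>)
        (x t \<omega> - \<eta> t *\<^sub>R (grad (f t \<omega> (x t \<omega>)) (x t \<omega>) - z t \<omega>)) (x (Suc t) \<omega>)"
    and xhat_Suc: "\<And>t \<omega>. \<omega> \<in> space M \<Longrightarrow>
      xhat (Suc t) \<omega> =
        (1 - (\<mu> - 2 * \<gamma>) * \<eta> t / (2 - \<mu> * \<eta> t)) *\<^sub>R xhat t \<omega>
        + ((\<mu> - 2 * \<gamma>) * \<eta> t / (2 - \<mu> * \<eta> t)) *\<^sub>R x (Suc t) \<omega>"

locale stochastic_framework = prob_space M
  for M :: "'w measure" +
  fixes \<F> :: "nat \<Rightarrow> 'w measure" and x xbar z :: "nat \<Rightarrow> 'w \<Rightarrow> 'e::euclidean_space"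
  assumes filt: "filtration (space M) \<F>"
    and subalg: "\<And>t. subalgebra M (\<F> t)"
    and trivial_0: "sets (\<F> 0) = {{}, space M}"
    and x_adapted: "\<And>t. x t \<in> borel_measurable (\<F> t)"
    and xbar_adapted: "\<And>t. xbar t \<in> borel_measurable (\<F> t)"
    and z_measurable: "\<And>t. z t \<in> borel_measurable (\<F> (Suc t))"
    and z_integrable: "\<And>t. integrable M (z t)"
    and z_cond_exp: "\<And>t. AE \<omega> in M. vec_cond_exp M (\<F> t) (z t) \<omega> = 0"

text \<open>The constant behind $\lesssim$. It has to be the same for every dimension and every
  probability space, that is, for all types; HOL cannot put an existential quantifier in front of
  a quantification over types, so one numeral is fixed. Its value is generous and immaterial.\<close>

definition absolute_constant :: real where
  "absolute_constant = 100"

end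

theory Submission
  imports Defs
begin

text \<open>
  Fix the horizon \<open>t\<close> and let \<open>p = xbar t\<close>. Minimality in the proximal step, the descent
  inequality and strong convexity of the loss at time \<open>t\<close> show, outcome by outcome, that one step
  contracts the potential formed by the gap of the average and
  \<open>\<mu>_hat / 4 * (norm (x i - p))\<^sup>2\<close> by the factor \<open>1 - \<rho>_hat\<close>, up to an error made of the squared
  gradient drift, the squared noise and \<open>z i \<bullet> (x i - p)\<close>. The gaps of \<open>xhat i\<close>, \<open>i < t\<close>, need not
  be measurable, so the recursion is unrolled pathwise and only then integrated; the inner products
  have mean zero, and the drift terms sum like \<open>(\<Sum>k. (1 - \<rho>_hat) ^ k * (k + 1)\<^sup>2)\<close>.

  For the comparison with the initial gap, stability of the minimizers bounds the gap of \<open>x 0\<close> at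
  time \<open>t\<close> by its gap at time \<open>0\<close> plus a drift term of mean at most of order \<open>t\<^sup>2\<close>, and
  \<open>(1 - \<rho>_hat) ^ t * t\<^sup>2\<close> is at most \<open>1 / \<rho>_hat\<^sup>2\<close> and tends to zero.
\<close>

section \<open>Strong convexity and smoothness\<close>

text \<open>\<open>grad\<close> is a definite description, so it says something only once existence
  and uniqueness are known. The representing vector is assembled from the values of the derivative
  on the basis.\<close>

lemma has_derivative_grad:
  fixes f :: "'e::euclidean_space \<Rightarrow> real"
  assumes "f differentiable (at u)"
  shows "(f has_derivative (\<lambda>h. h \<bullet> grad f u)) (at u)"
proof -
  obtain f' where f': "(f has_derivative f') (at u)"
    using assms by (auto simp: differentiable_def)
  then interpret bounded_linear f' by (rule has_derivative_bounded_linear)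
  define D where "D = (\<Sum>b\<in>Basis. f' b *\<^sub>R b)"
  have "f' h = h \<bullet> D" for h
  proof -
    have "f' h = f' (\<Sum>b\<in>Basis. (h \<bullet> b) *\<^sub>R b)"
      by (simp add: euclidean_representation)
    also have "\<dots> = h \<bullet> D"
      by (simp add: D_def sum scale inner_sum_right mult.commute)
    finally show ?thesis .
  qed
  then have "GDERIV f u :> D"
    using f' by (simp add: gderiv_def flip: \<open>\<And>h. f' h = h \<bullet> D\<close>)
  moreover have "E = D" if "GDERIV f u :> E" for E
    using has_derivative_unique[OF that[unfolded gderiv_def]
        \<open>GDERIV f u :> D\<close>[unfolded gderiv_def]]
    by (simp add: fun_eq_iff vector_eq_ldot)
  ultimately have "GDERIV f u :> grad f u"
    unfolding grad_def by (rule theI)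
  then show ?thesis by (simp add: gderiv_def)
qed

lemma DERIV_along_line:
  fixes f :: "'e::euclidean_space \<Rightarrow> real"
  assumes "\<And>u. f differentiable (at u)"
  shows "((\<lambda>s. f (x + s *\<^sub>R d)) has_real_derivative d \<bullet> grad f (x + s *\<^sub>R d)) (at s within S)"
proof -
  have 1: "((\<lambda>s. x + s *\<^sub>R d) has_derivative (\<lambda>h. h *\<^sub>R d)) (at s within S)"
    by (auto intro!: derivative_eq_intros)
  have 2: "(f has_derivative (\<lambda>h. h \<bullet> grad f (x + s *\<^sub>R d)))
      (at (x + s *\<^sub>R d) within (\<lambda>s. x + s *\<^sub>R d) ` S)"
    using has_derivative_grad[OF assms] by (rule has_derivative_at_withinI)
  show ?thesis
    using has_derivative_in_compose[OF 1 2]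
    by (simp add: has_field_derivative_def mult_commute_abs)
qed

text \<open>The descent inequality: along the segment from \<open>x\<close> to \<open>y\<close>, the
  defect \<open>g\<close> has derivative at most 0 by Cauchy-Schwarz and the Lipschitz
  bound.\<close>

lemma lipschitz_smooth_upper_bound:
  fixes f :: "'e::euclidean_space \<Rightarrow> real"
  assumes "lipschitz_smooth L f"
  shows "f y \<le> f x + grad f x \<bullet> (y - x) + L / 2 * (norm (y - x))\<^sup>2"
proof -
  define d where "d = y - x"
  define g where "g s = f (x + s *\<^sub>R d) - s * (grad f x \<bullet> d) - L / 2 * s\<^sup>2 * (norm d)\<^sup>2" for s :: real
  have diff: "f differentiable (at u)" for u
    using assms by (simp add: lipschitz_smooth_def)
  have lip: "norm (grad f u - grad f v) \<le> L * norm (u - v)" for u v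
    using assms by (auto simp: lipschitz_smooth_def lipschitz_on_def dist_norm)
  have "g 1 \<le> g 0"
  proof (rule DERIV_nonpos_imp_nonincreasing[where f = g])
    fix s :: real
    assume s: "0 \<le> s" "s \<le> 1"
    have "DERIV g s :> d \<bullet> grad f (x + s *\<^sub>R d) - grad f x \<bullet> d - L * s * (norm d)\<^sup>2"
      unfolding g_def using DERIV_along_line[OF diff, of x d s UNIV]
      by (auto intro!: derivative_eq_intros)
    moreover have "d \<bullet> grad f (x + s *\<^sub>R d) - grad f x \<bullet> d
        = (grad f (x + s *\<^sub>R d) - grad f x) \<bullet> d"
      by (simp add: inner_diff_left inner_commute[of d])
    moreover have "\<dots> \<le> norm (grad f (x + s *\<^sub>R d) - grad f x) * norm d"
      by (rule norm_cauchy_schwarz)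
    moreover have "\<dots> \<le> L * s * norm d * norm d"
      using lip[of "x + s *\<^sub>R d" x] s by (intro mult_right_mono) auto
    ultimately show "\<exists>y. DERIV g s :> y \<and> y \<le> 0"
      by (auto simp: power2_eq_square intro!: exI)
  qed simp
  then show ?thesis by (simp add: g_def d_def)
qed

text \<open>Restricted to the line through \<open>x\<close> and \<open>y\<close>, the loss minus its
  quadratic is convex and lies above its tangent at 0.\<close>

lemma strongly_convex_lower_bound:
  fixes f :: "'e::euclidean_space \<Rightarrow> real"
  assumes sc: "strongly_convex m f" and diff: "\<And>u. f differentiable (at u)"
  shows "f x + grad f x \<bullet> (y - x) + m / 2 * (norm (y - x))\<^sup>2 \<le> f y"
proof -
  define d where "d = y - x"
  define g where "g s = f (x + s *\<^sub>R d) - m / 2 * (norm (x + s *\<^sub>R d))\<^sup>2" for s :: real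
  have g_eq: "g s = f (x + s *\<^sub>R d) - m / 2 * (x \<bullet> x + 2 * s * (x \<bullet> d) + s\<^sup>2 * (d \<bullet> d))" for s
    unfolding g_def power2_norm_eq_inner
    by (simp add: inner_add_left inner_add_right power2_eq_square inner_commute algebra_simps)
  have "convex_on UNIV g"
  proof (rule convex_onI)
    fix t a b :: real
    assume t: "0 < t" "t < 1"
    have eq: "x + ((1 - t) *\<^sub>R a + t *\<^sub>R b) *\<^sub>R d
        = (1 - t) *\<^sub>R (x + a *\<^sub>R d) + t *\<^sub>R (x + b *\<^sub>R d)"
      by (simp add: algebra_simps)
    show "g ((1 - t) *\<^sub>R a + t *\<^sub>R b) \<le> (1 - t) * g a + t * g b"
      unfolding g_def eq using sc t
      by (intro convex_onD) (auto simp: strongly_convex_def)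
  qed simp
  moreover have "DERIV g 0 :> grad f x \<bullet> d - m * (x \<bullet> d)"
    unfolding g_eq[abs_def] using DERIV_along_line[OF diff, of x d 0 UNIV]
    by (auto intro!: derivative_eq_intros simp: inner_commute)
  ultimately have "(grad f x \<bullet> d - m * (x \<bullet> d)) * (1 - 0) \<le> g 1 - g 0"
    by (intro convex_on_imp_above_tangent[of UNIV g]) auto
  then have "grad f x \<bullet> d - m * (x \<bullet> d)
      \<le> f (x + d) - m / 2 * (x \<bullet> x + 2 * (x \<bullet> d) + d \<bullet> d) - f x + m / 2 * (x \<bullet> x)"
    by (simp add: g_eq)
  then show ?thesis
    by (simp add: d_def power2_norm_eq_inner algebra_simps add_divide_distrib)
qed

text \<open>The lower and upper quadratic bounds are compared at a point of distance 1 from the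
  origin; a basis vector provides one.\<close>

lemma strongly_convex_le_smooth:
  fixes f :: "'e::euclidean_space \<Rightarrow> real"
  assumes "strongly_convex m f" "lipschitz_smooth L f"
  shows "m \<le> L"
proof -
  obtain b :: 'e where b: "b \<in> Basis" using nonempty_Basis by blast
  have "f differentiable (at u)" for u
    using assms(2) by (simp add: lipschitz_smooth_def)
  from strongly_convex_lower_bound[OF assms(1) this, of 0 b]
    lipschitz_smooth_upper_bound[OF assms(2), of b 0] show ?thesis
    using b by simp
qed

lemma strongly_convexD:
  assumes "strongly_convex m f" "0 \<le> s" "s \<le> 1"
  shows "f ((1 - s) *\<^sub>R a + s *\<^sub>R b)
    \<le> (1 - s) * f a + s * f b - m / 2 * s * (1 - s) * (norm (b - a))\<^sup>2"
proof -
  define c where "c = (1 - s) *\<^sub>R a + s *\<^sub>R b"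
  have N: "(norm c)\<^sup>2 = (1 - s) * (norm a)\<^sup>2 + s * (norm b)\<^sup>2 - s * (1 - s) * (norm (b - a))\<^sup>2"
    unfolding c_def power2_norm_eq_inner
    by (simp add: inner_add_left inner_add_right inner_diff_left inner_diff_right inner_commute)
      (simp add: algebra_simps)
  have "f c - m / 2 * (norm c)\<^sup>2
      \<le> (1 - s) * (f a - m / 2 * (norm a)\<^sup>2) + s * (f b - m / 2 * (norm b)\<^sup>2)"
    using assms unfolding c_def by (intro convex_onD) (auto simp: strongly_convex_def)
  then show ?thesis
    unfolding N c_def[symmetric] by (simp add: field_simps)
qed

text \<open>Subtracting the quadratic leaves an affine function. This supplies the strong convexity
  of the proximal objective.\<close>

lemma strongly_convex_dist:
  "strongly_convex m (\<lambda>u. m / 2 * (norm (u - v))\<^sup>2)"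
proof -
  have eq: "m / 2 * (norm (u - v))\<^sup>2 - m / 2 * (norm u)\<^sup>2 = m / 2 * (v \<bullet> v) - m * (u \<bullet> v)" for u
    by (simp add: power2_norm_eq_inner algebra_simps inner_commute diff_divide_distrib)
  show ?thesis
    unfolding strongly_convex_def eq
    by (rule convex_onI) (auto simp: inner_add_left inner_diff_left field_simps)
qed

text \<open>The minimizer is compared with points of the segment towards \<open>u\<close>. This
  avoids a first-order condition, which would call for subgradients of
  \<open>\<phi>\<close>.\<close>

lemma quadratic_growth:
  fixes h :: "'e::euclidean_space \<Rightarrow> real"
  assumes h: "strongly_convex m h" and \<phi>: "convex_on C \<phi>"
    and p: "p \<in> C" "\<And>u. u \<in> C \<Longrightarrow> h p + \<phi> p \<le> h u + \<phi> u" and u: "u \<in> C"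
  shows "h p + \<phi> p + m / 2 * (norm (u - p))\<^sup>2 \<le> h u + \<phi> u"
proof -
  define q where "q = m / 2 * (norm (u - p))\<^sup>2"
  define D where "D = h u + \<phi> u - (h p + \<phi> p)"
  have "(1 - s) * q \<le> D" if s: "0 < s" "s < 1" for s
  proof -
    define c where "c = (1 - s) *\<^sub>R p + s *\<^sub>R u"
    have "c \<in> C"
      using \<phi> p u s unfolding c_def convex_on_def by (intro convexD) auto
    then have "h p + \<phi> p \<le> h c + \<phi> c" by (rule p)
    also have "h c \<le> (1 - s) * h p + s * h u - m / 2 * s * (1 - s) * (norm (u - p))\<^sup>2"
      unfolding c_def using h s by (intro strongly_convexD) auto
    also have "\<phi> c \<le> (1 - s) * \<phi> p + s * \<phi> u"
      unfolding c_def using \<phi> p u s by (intro convex_onD) auto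
    finally have "0 \<le> s * (D - (1 - s) * q)"
      by (simp add: D_def q_def algebra_simps)
    then show ?thesis using s by (simp add: zero_le_mult_iff)
  qed
  \<comment> \<open>Each \<open>s\<close> loses a factor \<open>1 - s\<close>; the full constant
    \<open>m / 2\<close> appears in the limit \<open>s\<close> to 0.\<close>
  then have "eventually (\<lambda>s. (1 - s) * q \<le> D) (at_right 0)"
    by (intro eventually_at_rightI[of 0 1]) auto
  moreover have "((\<lambda>s. (1 - s) * q) \<longlongrightarrow> (1 - 0) * q) (at_right 0)"
    by (intro tendsto_intros)
  ultimately have "(1 - 0) * q \<le> D"
    by (intro tendsto_upperbound) auto
  then show ?thesis by (simp add: D_def q_def)
qed

section \<open>Proximal steps and minimizers\<close>

text \<open>The coefficients of \<open>(norm (x' - p))\<^sup>2\<close> and \<open>(norm (x - p))\<^sup>2\<close> are in the ratio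
  \<open>1 : 1 - \<rho>\<close> for the averaging weight \<open>\<rho>\<close> of the algorithm; the weight \<open>(\<mu> - 2 * \<gamma>) / 4\<close> in the use of
  Young's inequality on the error term is chosen for this purpose.\<close>

lemma prox_step:
  fixes x p x' g z :: "'e::euclidean_space"
  assumes h: "strongly_convex \<mu> h" "lipschitz_smooth L h" and \<phi>: "convex_on C \<phi>"
    and p: "p \<in> C" and x': "x' \<in> C"
    and prox: "\<And>u. u \<in> C \<Longrightarrow> 1 / (2 * \<eta>) * (norm (x' - (x - \<eta> *\<^sub>R g)))\<^sup>2 + \<phi> x'
      \<le> 1 / (2 * \<eta>) * (norm (u - (x - \<eta> *\<^sub>R g)))\<^sup>2 + \<phi> u"
    and \<eta>: "0 < \<eta>" "\<eta> \<le> 1 / (2 * L)" "0 < L"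
    and \<gamma>: "0 \<le> \<gamma>" "\<gamma> < \<mu> / 2"
    and err: "norm (grad h x - g - z) \<le> \<gamma> * norm (x - p) + G"
  shows "h x' + \<phi> x' - (h p + \<phi> p) + (1 / (2 * \<eta>) - \<mu> / 4) * (norm (x' - p))\<^sup>2
    \<le> (1 / (2 * \<eta>) - \<mu> / 2 + \<gamma> / 2) * (norm (x - p))\<^sup>2
      + (G\<^sup>2 / (\<mu> - 2 * \<gamma>) + z \<bullet> (x - p) + \<eta> * (norm z)\<^sup>2)"
proof -
  define k where "k = 1 / (2 * \<eta>)"
  define a b w e where "a = norm (x - p)" and "b = norm (x' - p)" and "w = norm (x' - x)"
    and "e = grad h x - g - z"
  \<comment> \<open>The step size bound enters as \<open>L \<le> k\<close>: of the term
    \<open>k * w^2\<close> gained below, one half absorbs the smoothness error and the other half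
    the noise.\<close>
  have k: "0 < k" "L \<le> k" using \<eta> by (auto simp: k_def field_simps)
  have "k * (norm (x' - (x - \<eta> *\<^sub>R g)))\<^sup>2 + \<phi> x' + k * (norm (p - x'))\<^sup>2
      \<le> k * (norm (p - (x - \<eta> *\<^sub>R g)))\<^sup>2 + \<phi> p"
    using quadratic_growth[OF strongly_convex_dist[of "2 * k" "x - \<eta> *\<^sub>R g"] \<phi> x' _ p] prox
    unfolding k_def[symmetric] by simp
  moreover have "k * (norm (u - (x - \<eta> *\<^sub>R g)))\<^sup>2
      = k * (norm (u - x))\<^sup>2 + g \<bullet> (u - x) + k * \<eta>\<^sup>2 * (norm g)\<^sup>2" for u
  proof -
    have "(norm (u - (x - \<eta> *\<^sub>R g)))\<^sup>2 = (norm ((u - x) + \<eta> *\<^sub>R g))\<^sup>2"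
      by (simp add: algebra_simps)
    also have "\<dots> = (norm (u - x))\<^sup>2 + 2 * \<eta> * (g \<bullet> (u - x)) + \<eta>\<^sup>2 * (norm g)\<^sup>2"
      unfolding power2_norm_eq_inner inner_add_left inner_add_right
      by (simp add: inner_commute power2_eq_square)
    finally show ?thesis
      using \<eta> by (simp add: k_def field_simps)
  qed
  ultimately have 1: "k * w\<^sup>2 + g \<bullet> (x' - x) + \<phi> x' + k * b\<^sup>2 \<le> k * a\<^sup>2 + g \<bullet> (p - x) + \<phi> p"
    by (simp add: a_def b_def w_def norm_minus_commute)
  have 2: "h x' \<le> h x + grad h x \<bullet> (x' - x) + L / 2 * w\<^sup>2"
    using lipschitz_smooth_upper_bound[OF h(2)] by (simp add: w_def)
  have 3: "h x + grad h x \<bullet> (p - x) + \<mu> / 2 * a\<^sup>2 \<le> h p"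
    using strongly_convex_lower_bound[OF h(1), of x p] h(2)
    by (simp add: a_def lipschitz_smooth_def norm_minus_commute)
  \<comment> \<open>The noise is paired with \<open>x - p\<close>, which will be orthogonal to it in
    mean, and with \<open>x' - x\<close>, which depends on the noise and is estimated by Young's
    inequality.\<close>
  have 4: "(grad h x \<bullet> (x' - x) - grad h x \<bullet> (p - x)) - (g \<bullet> (x' - x) - g \<bullet> (p - x))
      = e \<bullet> (x' - p) + z \<bullet> (x - p) + z \<bullet> (x' - x)"
    by (simp add: e_def inner_diff_left inner_diff_right)
  have "e \<bullet> (x' - p) \<le> norm e * b"
    unfolding b_def by (rule norm_cauchy_schwarz)
  also have "\<dots> \<le> (\<gamma> * a + G) * b"
    using err by (intro mult_right_mono) (auto simp: e_def a_def b_def)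
  also have "\<dots> \<le> \<gamma> / 2 * (a\<^sup>2 + b\<^sup>2) + (G\<^sup>2 / (\<mu> - 2 * \<gamma>) + (\<mu> - 2 * \<gamma>) / 4 * b\<^sup>2)"
  proof -
    have "0 \<le> \<gamma> / 2 * (a - b)\<^sup>2" using \<gamma> by simp
    moreover have "0 \<le> (G - (\<mu> - 2 * \<gamma>) / 2 * b)\<^sup>2 / (\<mu> - 2 * \<gamma>)" using \<gamma> by simp
    moreover have "(G - (\<mu> - 2 * \<gamma>) / 2 * b)\<^sup>2 / (\<mu> - 2 * \<gamma>)
        = G\<^sup>2 / (\<mu> - 2 * \<gamma>) - G * b + (\<mu> - 2 * \<gamma>) / 4 * b\<^sup>2"
    proof -
      have "(G - m / 2 * b)\<^sup>2 / m = G\<^sup>2 / m - G * b + m / 4 * b\<^sup>2" if "m > 0" for m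
        using that by (simp add: field_simps power2_eq_square)
      from this[of "\<mu> - 2 * \<gamma>"] \<gamma> show ?thesis by simp
    qed
    ultimately show ?thesis
      by (simp add: power2_diff algebra_simps)
  qed
  \<comment> \<open>The two coefficients of \<open>b^2\<close> add up to \<open>\<mu> / 4\<close>,
    so \<open>\<gamma>\<close> drops out of the coefficient after the step.\<close>
  also have "\<dots> = \<gamma> / 2 * a\<^sup>2 + \<mu> / 4 * b\<^sup>2 + G\<^sup>2 / (\<mu> - 2 * \<gamma>)"
    by (simp add: algebra_simps diff_divide_distrib)
  finally have 5: "e \<bullet> (x' - p) \<le> \<gamma> / 2 * a\<^sup>2 + \<mu> / 4 * b\<^sup>2 + G\<^sup>2 / (\<mu> - 2 * \<gamma>)" .
  have "z \<bullet> (x' - x) \<le> norm z * w"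
    unfolding w_def by (rule norm_cauchy_schwarz)
  also have "\<dots> \<le> \<eta> * (norm z)\<^sup>2 + k / 2 * w\<^sup>2"
  proof -
    have "0 \<le> \<eta> * (norm z - k * w)\<^sup>2" using \<eta> by simp
    also have "\<dots> = \<eta> * (norm z)\<^sup>2 - norm z * w + k / 2 * w\<^sup>2"
      using \<eta> by (simp add: k_def field_simps power2_eq_square)
    finally show ?thesis by simp
  qed
  finally have 6: "z \<bullet> (x' - x) \<le> \<eta> * (norm z)\<^sup>2 + k / 2 * w\<^sup>2" .
  have 7: "L / 2 * w\<^sup>2 \<le> k / 2 * w\<^sup>2" using k by (intro mult_right_mono) auto
  show ?thesis
    unfolding k_def[symmetric] a_def[symmetric] b_def[symmetric]
    using 1 2 3 4 5 6 7 unfolding distrib_right left_diff_distrib by linarith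
qed

text \<open>Discrete Gronwall: an error made in step \<open>i\<close> is damped by the
  \<open>n - Suc i\<close> steps that follow it.\<close>

lemma geometric_recursion_bound:
  fixes \<Phi> :: "nat \<Rightarrow> real"
  assumes "\<And>i. i < n \<Longrightarrow> \<Phi> (Suc i) \<le> q * \<Phi> i + e i" "0 \<le> q"
  shows "\<Phi> n \<le> q ^ n * \<Phi> 0 + (\<Sum>i<n. q ^ (n - Suc i) * e i)"
  using assms(1)
proof (induction n)
  case (Suc n)
  have "q * (\<Sum>i<n. q ^ (n - Suc i) * e i) = (\<Sum>i<n. q ^ (n - i) * e i)"
    unfolding sum_distrib_left
    by (intro sum.cong refl) (simp add: Suc_diff_Suc flip: power_Suc mult.assoc)
  moreover have "q * \<Phi> n \<le> q * (q ^ n * \<Phi> 0 + (\<Sum>i<n. q ^ (n - Suc i) * e i))"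
    using Suc assms(2) by (intro mult_left_mono) auto
  ultimately show ?case
    using Suc.prems[of n] by (simp add: algebra_simps)
qed simp

lemma strongly_convex_imp_convex_on:
  assumes "strongly_convex m h" "0 \<le> m"
  shows "convex_on UNIV h"
proof (rule convex_onI)
  fix t :: real and a b
  assume "0 < t" "t < 1"
  then show "h ((1 - t) *\<^sub>R a + t *\<^sub>R b) \<le> (1 - t) * h a + t * h b"
    using strongly_convexD[OF assms(1), of t a b] assms(2)
    by (smt (verit) mult_nonneg_nonneg zero_le_power2 divide_nonneg_nonneg)
qed simp

text \<open>The objective is frozen at the horizon. Convexity bounds the gap of the average by the
  weighted gaps, and \<open>\<rho>\<close> times \<open>prox_step\<close> bounds the new gap, so the
  potential contracts at every step.\<close>

lemma averaged_prox_gap_bound: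
  fixes x xh z g :: "nat \<Rightarrow> 'e::euclidean_space"
  assumes h: "strongly_convex \<mu> h" "lipschitz_smooth L h" and \<phi>: "convex_on C \<phi>"
    and p: "p \<in> C"
    and x0: "x 0 \<in> C" "xh 0 = x 0"
    and x_Suc: "\<And>i. x (Suc i) \<in> C"
    and prox: "\<And>i u. u \<in> C \<Longrightarrow>
      1 / (2 * \<eta>) * (norm (x (Suc i) - (x i - \<eta> *\<^sub>R g i)))\<^sup>2 + \<phi> (x (Suc i))
      \<le> 1 / (2 * \<eta>) * (norm (u - (x i - \<eta> *\<^sub>R g i)))\<^sup>2 + \<phi> u"
    and xh_Suc: "\<And>i. xh (Suc i) = (1 - \<rho>) *\<^sub>R xh i + \<rho> *\<^sub>R x (Suc i)"
    and \<eta>: "0 < \<eta>" "\<eta> \<le> 1 / (2 * L)" "0 < L"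
    and \<gamma>: "0 \<le> \<gamma>" "\<gamma> < \<mu> / 2"
    and \<rho>: "\<rho> = (\<mu> - 2 * \<gamma>) * \<eta> / (2 - \<mu> * \<eta>)" "0 < \<rho>" "\<rho> \<le> 1"
    and err: "\<And>i. i < t \<Longrightarrow> norm (grad h (x i) - g i - z i) \<le> \<gamma> * norm (x i - p) + G i"
  shows "xh t \<in> C"
    and "h (xh t) + \<phi> (xh t) - (h p + \<phi> p) + (\<mu> - 2 * \<gamma>) / 4 * (norm (x t - p))\<^sup>2
      \<le> (1 - \<rho>) ^ t * (h (x 0) + \<phi> (x 0) - (h p + \<phi> p)
          + (\<mu> - 2 * \<gamma>) / 4 * (norm (x 0 - p))\<^sup>2)
        + (\<Sum>i<t. (1 - \<rho>) ^ (t - Suc i) *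
            (\<rho> * ((G i)\<^sup>2 / (\<mu> - 2 * \<gamma>) + z i \<bullet> (x i - p) + \<eta> * (norm (z i))\<^sup>2)))"
proof -
  define F where "F u = h u + \<phi> u - (h p + \<phi> p)" for u
  define e where "e i = (G i)\<^sup>2 / (\<mu> - 2 * \<gamma>) + z i \<bullet> (x i - p) + \<eta> * (norm (z i))\<^sup>2" for i
  have C: "convex C" using \<phi> by (simp add: convex_on_def)
  have xhC: "xh i \<in> C" for i
  proof (induction i)
    case (Suc i)
    then show ?case
      using C x_Suc[of i] \<rho> unfolding xh_Suc by (intro convexD) auto
  qed (simp add: x0)
  then show "xh t \<in> C" .
  have F: "F ((1 - \<rho>) *\<^sub>R u + \<rho> *\<^sub>R v) \<le> (1 - \<rho>) * F u + \<rho> * F v" if "u \<in> C" "v \<in> C" for u v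
  proof -
    have "h ((1 - \<rho>) *\<^sub>R u + \<rho> *\<^sub>R v) \<le> (1 - \<rho>) * h u + \<rho> * h v"
      using strongly_convex_imp_convex_on[OF h(1)] \<gamma> \<rho> by (intro convex_onD) auto
    moreover have "\<phi> ((1 - \<rho>) *\<^sub>R u + \<rho> *\<^sub>R v) \<le> (1 - \<rho>) * \<phi> u + \<rho> * \<phi> v"
      using \<phi> \<rho> that by (intro convex_onD) auto
    ultimately show ?thesis unfolding F_def by (simp add: algebra_simps)
  qed
  have "\<mu> \<le> L" using h by (rule strongly_convex_le_smooth)
  then have "\<mu> * \<eta> \<le> L * \<eta>" using \<eta> by (intro mult_right_mono) auto
  also have "\<dots> \<le> 1 / 2" using \<eta> by (simp add: field_simps)
  finally have "\<mu> * \<eta> < 2" by simp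
  \<comment> \<open>This identity and the next one explain the averaging weight: with it, the
    distance term contracts by the same factor \<open>1 - \<rho>\<close> as the gap of the
    average.\<close>
  then have A: "\<rho> * (1 / (2 * \<eta>) - \<mu> / 4) = (\<mu> - 2 * \<gamma>) / 4"
    using \<eta> unfolding \<rho> by (simp add: field_simps)
  have B: "1 / (2 * \<eta>) - \<mu> / 2 + \<gamma> / 2 = (1 - \<rho>) * (1 / (2 * \<eta>) - \<mu> / 4)"
    unfolding left_diff_distrib[of 1 \<rho>] A by (simp add: diff_divide_distrib)
  have "F (xh (Suc i)) + (\<mu> - 2 * \<gamma>) / 4 * (norm (x (Suc i) - p))\<^sup>2
      \<le> (1 - \<rho>) * (F (xh i) + (\<mu> - 2 * \<gamma>) / 4 * (norm (x i - p))\<^sup>2) + \<rho> * e i" if "i < t" for i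
  proof -
    have "F (x (Suc i)) + (1 / (2 * \<eta>) - \<mu> / 4) * (norm (x (Suc i) - p))\<^sup>2
        \<le> (1 - \<rho>) * (1 / (2 * \<eta>) - \<mu> / 4) * (norm (x i - p))\<^sup>2 + e i"
      using prox_step[OF h \<phi> p x_Suc prox \<eta> \<gamma> err[OF that]] unfolding B F_def e_def by simp
    then have "\<rho> * (F (x (Suc i)) + (1 / (2 * \<eta>) - \<mu> / 4) * (norm (x (Suc i) - p))\<^sup>2)
        \<le> \<rho> * ((1 - \<rho>) * (1 / (2 * \<eta>) - \<mu> / 4) * (norm (x i - p))\<^sup>2 + e i)"
      using \<rho> by (intro mult_left_mono) auto
    then have "\<rho> * F (x (Suc i)) + (\<rho> * (1 / (2 * \<eta>) - \<mu> / 4)) * (norm (x (Suc i) - p))\<^sup>2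
        \<le> (1 - \<rho>) * ((\<rho> * (1 / (2 * \<eta>) - \<mu> / 4)) * (norm (x i - p))\<^sup>2) + \<rho> * e i"
      by (simp only: distrib_left mult_ac)
    with F[OF xhC x_Suc, of i i] show ?thesis
      unfolding A xh_Suc by (simp only: distrib_left)
  qed
  from geometric_recursion_bound[of t "\<lambda>i. F (xh i) + (\<mu> - 2 * \<gamma>) / 4 * (norm (x i - p))\<^sup>2"
      "1 - \<rho>" "\<lambda>i. \<rho> * e i", OF this] \<rho>
  show "h (xh t) + \<phi> (xh t) - (h p + \<phi> p) + (\<mu> - 2 * \<gamma>) / 4 * (norm (x t - p))\<^sup>2
      \<le> (1 - \<rho>) ^ t * (h (x 0) + \<phi> (x 0) - (h p + \<phi> p)
          + (\<mu> - 2 * \<gamma>) / 4 * (norm (x 0 - p))\<^sup>2)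
        + (\<Sum>i<t. (1 - \<rho>) ^ (t - Suc i) *
            (\<rho> * ((G i)\<^sup>2 / (\<mu> - 2 * \<gamma>) + z i \<bullet> (x i - p) + \<eta> * (norm (z i))\<^sup>2)))"
    unfolding F_def e_def x0(2) by simp
qed

section \<open>Stability of minimizers under drift\<close>

text \<open>The mean value inequality for \<open>h - k\<close>.\<close>

lemma diff_le_of_grad_diff_le:
  fixes h k :: "'e::euclidean_space \<Rightarrow> real"
  assumes "\<And>u. h differentiable (at u)" "\<And>u. k differentiable (at u)"
    and K: "\<And>u. norm (grad h u - grad k u) \<le> K"
  shows "(h a - k a) - (h b - k b) \<le> K * norm (a - b)"
proof -
  have "norm ((h a - k a) - (h b - k b)) \<le> K * norm (a - b)"
  proof (rule differentiable_bound[of UNIV])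
    show "((\<lambda>u. h u - k u) has_derivative (\<lambda>v. v \<bullet> grad h u - v \<bullet> grad k u)) (at u within UNIV)" for u
      by (intro has_derivative_diff has_derivative_grad assms)
    show "onorm (\<lambda>v. v \<bullet> grad h u - v \<bullet> grad k u) \<le> K" for u
    proof (rule onorm_le)
      fix v
      have "norm (v \<bullet> grad h u - v \<bullet> grad k u) \<le> norm v * norm (grad h u - grad k u)"
        using Cauchy_Schwarz_ineq2 by (simp flip: inner_diff_right)
      also have "\<dots> \<le> norm v * K" by (intro mult_left_mono K) simp
      finally show "norm (v \<bullet> grad h u - v \<bullet> grad k u) \<le> K * norm v"
        by (simp add: mult.commute)
    qed
  qed auto
  then show ?thesis by simp
qed

text \<open>Quadratic growth of both objectives at their minimizers gives
  \<open>(\<mu> - \<gamma>) * norm (p - q) \<le> G\<close>, so the two gradients differ by at most \<open>2 * G\<close> everywhere.\<close>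

lemma gap_transfer:
  fixes h k :: "'e::euclidean_space \<Rightarrow> real"
  assumes h: "strongly_convex \<mu> h" "\<And>u. h differentiable (at u)"
    and k: "strongly_convex \<mu> k" "\<And>u. k differentiable (at u)"
    and \<phi>: "convex_on C \<phi>"
    and p: "p \<in> C" "\<And>u. u \<in> C \<Longrightarrow> h p + \<phi> p \<le> h u + \<phi> u"
    and q: "q \<in> C" "\<And>u. u \<in> C \<Longrightarrow> k q + \<phi> q \<le> k u + \<phi> u"
    and \<gamma>: "0 \<le> \<gamma>" "\<gamma> < \<mu> / 2" and G: "0 \<le> G"
    and grads: "\<And>u. norm (grad h u - grad k u) \<le> G + \<gamma> * norm (p - q)"
    and u: "u \<in> C"
  shows "k u + \<phi> u - (k q + \<phi> q) \<le> 2 * (h u + \<phi> u - (h p + \<phi> p)) + 8 * G\<^sup>2 / \<mu>"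
proof -
  define K d s D where "K = G + \<gamma> * norm (p - q)" and "d = norm (p - q)" and "s = norm (u - q)"
    and "D = k u + \<phi> u - (k q + \<phi> q)"
  have g1: "h p + \<phi> p + \<mu> / 2 * d\<^sup>2 \<le> h q + \<phi> q"
    using quadratic_growth[OF h(1) \<phi> p q(1)] by (simp add: d_def norm_minus_commute)
  have g2: "k q + \<phi> q + \<mu> / 2 * d\<^sup>2 \<le> k p + \<phi> p"
    using quadratic_growth[OF k(1) \<phi> q p(1)] by (simp add: d_def)
  have g3: "\<mu> / 2 * s\<^sup>2 \<le> D"
    using quadratic_growth[OF k(1) \<phi> q u] by (simp add: s_def D_def)
  have grads': "norm (grad k u - grad h u) \<le> K" for u
    using grads[of u] by (simp add: K_def norm_minus_commute)
  have "(k p - h p) - (k q - h q) \<le> K * d"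
    using diff_le_of_grad_diff_le[OF k(2) h(2) grads'] by (simp add: d_def)
  with g1 g2 have "\<mu> * d * d \<le> K * d" by (simp add: power2_eq_square)
  moreover have "0 \<le> d" by (simp add: d_def)
  \<comment> \<open>Cancelling \<open>d\<close> requires \<open>d > 0\<close>; for
    \<open>d = 0\<close> the next bound reduces to \<open>0 \<le> G\<close>.\<close>
  ultimately have "\<mu> * d \<le> K \<or> d = 0" using mult_right_le_imp_le[of "\<mu> * d" d K] by fastforce
  then have "(\<mu> - \<gamma>) * d \<le> G"
    using G by (auto simp: K_def d_def[symmetric] algebra_simps)
  moreover have "\<gamma> * d \<le> (\<mu> - \<gamma>) * d"
    using \<gamma> \<open>0 \<le> d\<close> by (intro mult_right_mono) auto
  ultimately have "K \<le> 2 * G" by (simp add: K_def d_def[symmetric])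
  have "(k u - h u) - (k q - h q) \<le> K * s"
    using diff_le_of_grad_diff_le[OF k(2) h(2) grads'] by (simp add: s_def)
  also have "\<dots> \<le> 2 * G * s"
    using \<open>K \<le> 2 * G\<close> by (intro mult_right_mono) (auto simp: s_def)
  \<comment> \<open>Weighted so that quadratic growth turns the last term into \<open>D / 2\<close>;
    absorbing it on the left produces the factor 2 in the conclusion.\<close>
  also have "\<dots> \<le> 4 * G\<^sup>2 / \<mu> + \<mu> / 4 * s\<^sup>2"
  proof -
    have "0 \<le> (2 * G - \<mu> / 2 * s)\<^sup>2 / \<mu>" using \<gamma> by simp
    also have "\<dots> = 4 * G\<^sup>2 / \<mu> - 2 * G * s + \<mu> / 4 * s\<^sup>2"
      using \<gamma> by (simp add: field_simps power2_eq_square)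
    finally show ?thesis by simp
  qed
  finally have "D \<le> h u + \<phi> u - (h q + \<phi> q) + 4 * G\<^sup>2 / \<mu> + D / 2"
    using g3 unfolding D_def by argo
  with p(2)[OF q(1)] have "D / 2 \<le> h u + \<phi> u - (h p + \<phi> p) + 4 * G\<^sup>2 / \<mu>"
    by simp
  then show ?thesis by (simp add: D_def)
qed

section \<open>From extended-real to real objectives\<close>

text \<open>Here \<open>\<rho>\<close> is a regularizer. Convexity of its epigraph becomes real
  convexity on the set where it is finite, which serves as the set \<open>C\<close> of the preceding
  lemmas.\<close>

lemma effective_domain:
  assumes "proper_closed_convex \<rho>"
  shows "convex_on {u. \<rho> u \<noteq> \<infinity>} (\<lambda>u. real_of_ereal (\<rho> u))"
    and "\<rho> u \<noteq> \<infinity> \<Longrightarrow> \<rho> u = ereal (real_of_ereal (\<rho> u))"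
proof -
  have real: "\<rho> u = ereal (real_of_ereal (\<rho> u))" if "\<rho> u \<noteq> \<infinity>" for u
    using that assms by (auto simp: proper_closed_convex_def ereal_real)
  then show "\<rho> u \<noteq> \<infinity> \<Longrightarrow> \<rho> u = ereal (real_of_ereal (\<rho> u))" .
  have mid: "\<rho> (s *\<^sub>R a + t *\<^sub>R b) \<le> ereal (s * real_of_ereal (\<rho> a) + t * real_of_ereal (\<rho> b))"
    if "\<rho> a \<noteq> \<infinity>" "\<rho> b \<noteq> \<infinity>" "0 \<le> s" "0 \<le> t" "s + t = 1" for a b s t
  proof -
    have "convex (epi \<rho>)" using assms by (simp add: proper_closed_convex_def)
    moreover have "(a, real_of_ereal (\<rho> a)) \<in> epi \<rho>" "(b, real_of_ereal (\<rho> b)) \<in> epi \<rho>"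
      using real that by (auto simp: epi_def)
    ultimately have "s *\<^sub>R (a, real_of_ereal (\<rho> a)) + t *\<^sub>R (b, real_of_ereal (\<rho> b)) \<in> epi \<rho>"
      using that by (intro convexD)
    then show ?thesis by (simp add: epi_def)
  qed
  have fin: "\<rho> (s *\<^sub>R a + t *\<^sub>R b) \<noteq> \<infinity>"
    if "\<rho> a \<noteq> \<infinity>" "\<rho> b \<noteq> \<infinity>" "0 \<le> s" "0 \<le> t" "s + t = 1" for a b s t
    using mid[OF that] by auto
  show "convex_on {u. \<rho> u \<noteq> \<infinity>} (\<lambda>u. real_of_ereal (\<rho> u))"
    unfolding convex_on_def
  proof (intro conjI ballI allI impI)
    show "convex {u. \<rho> u \<noteq> \<infinity>}" using fin by (auto intro!: convexI)
    fix a b s t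
    assume *: "a \<in> {u. \<rho> u \<noteq> \<infinity>}" "b \<in> {u. \<rho> u \<noteq> \<infinity>}" "0 \<le> s" "0 \<le> t" "s + t = (1::real)"
    then show "real_of_ereal (\<rho> (s *\<^sub>R a + t *\<^sub>R b))
        \<le> s * real_of_ereal (\<rho> a) + t * real_of_ereal (\<rho> b)"
      using mid[of a b s t] real[OF fin[of a b s t]]
      by (cases "\<rho> (s *\<^sub>R a + t *\<^sub>R b)") auto
  qed
qed

text \<open>Properness gives one point of finite value, so a minimizer has finite value too. The
  lemma serves equilibria and proximal points alike.\<close>

lemma is_minimizer_real:
  assumes "proper_closed_convex \<rho>" "is_minimizer (\<lambda>u. ereal (h u) + \<rho> u) p"
  shows "\<rho> p \<noteq> \<infinity>"
    and "\<rho> u \<noteq> \<infinity> \<Longrightarrow> h p + real_of_ereal (\<rho> p) \<le> h u + real_of_ereal (\<rho> u)"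
proof -
  have min: "ereal (h p) + \<rho> p \<le> ereal (h v) + \<rho> v" for v
    using assms(2) by (auto simp: is_minimizer_def is_arg_min_def not_less)
  obtain v where v: "\<rho> v \<noteq> \<infinity>" using assms(1) by (auto simp: proper_closed_convex_def)
  show p: "\<rho> p \<noteq> \<infinity>"
    using min[of v] v by (cases "\<rho> v") auto
  show "h p + real_of_ereal (\<rho> p) \<le> h u + real_of_ereal (\<rho> u)" if u: "\<rho> u \<noteq> \<infinity>"
    using min[of u] effective_domain(2)[OF assms(1) u] effective_domain(2)[OF assms(1) p]
    by (cases "\<rho> u"; cases "\<rho> p") auto
qed

text \<open>The infimum is attained at the equilibrium, so the gap is a difference of real values on
  the effective domain and infinite outside it.\<close>

lemma gap_eq:
  assumes \<rho>: "proper_closed_convex (r t \<omega>)"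
    and min: "is_minimizer (psi f r t \<omega> (xbar t \<omega>)) (xbar t \<omega>)"
  shows "gap f r xbar t \<omega> u = (if r t \<omega> u = \<infinity> then \<infinity> else
    ereal (f t \<omega> (xbar t \<omega>) u + real_of_ereal (r t \<omega> u)
      - (f t \<omega> (xbar t \<omega>) (xbar t \<omega>) + real_of_ereal (r t \<omega> (xbar t \<omega>)))))"
proof -
  have psi: "psi f r t \<omega> (xbar t \<omega>) = (\<lambda>u. ereal (f t \<omega> (xbar t \<omega>) u) + r t \<omega> u)"
    by (simp add: psi_def fun_eq_iff)
  have "(INF v. psi f r t \<omega> (xbar t \<omega>) v) = psi f r t \<omega> (xbar t \<omega>) (xbar t \<omega>)"
    using min by (intro antisym INF_lower INF_greatest)
      (auto simp: is_minimizer_def is_arg_min_def not_less)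
  moreover note effective_domain(2)[OF \<rho> is_minimizer_real(1)[OF \<rho> min[unfolded psi]]]
    effective_domain(2)[OF \<rho>, of u]
  ultimately show ?thesis
    unfolding gap_def psi_def
    by (cases "r t \<omega> u"; cases "r t \<omega> (xbar t \<omega>)") auto
qed

section \<open>Expectations and weighted sums\<close>

text \<open>The error terms have no fixed sign and need Bochner integrals; finiteness of
  \<open>expect\<close> allows the passage to them.\<close>

lemma expect_finiteD:
  assumes [measurable]: "Y \<in> borel_measurable M" and pos: "AE \<omega> in M. 0 \<le> Y \<omega>"
    and fin: "expect M Y \<noteq> \<infinity>"
  shows "AE \<omega> in M. Y \<omega> = ereal (real_of_ereal (Y \<omega>))"
    and "integrable M (\<lambda>\<omega>. real_of_ereal (Y \<omega>))"
    and "expect M Y = ereal (\<integral>\<omega>. real_of_ereal (Y \<omega>) \<partial>M)"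
proof -
  have nn: "(\<integral>\<^sup>+\<omega>. e2ennreal (Y \<omega>) \<partial>M) \<noteq> \<infinity>"
    using fin by (auto simp: expect_def)
  then have "AE \<omega> in M. e2ennreal (Y \<omega>) \<noteq> \<infinity>"
    by (intro nn_integral_noteq_infinite) auto
  with pos show eq: "AE \<omega> in M. Y \<omega> = ereal (real_of_ereal (Y \<omega>))"
  proof eventually_elim
    case (elim \<omega>)
    then show ?case by (cases "Y \<omega>") auto
  qed
  have pos': "AE \<omega> in M. 0 \<le> real_of_ereal (Y \<omega>)"
    using pos by eventually_elim (rule real_of_ereal_pos)
  have int: "(\<integral>\<^sup>+\<omega>. e2ennreal (Y \<omega>) \<partial>M) = (\<integral>\<^sup>+\<omega>. ennreal (real_of_ereal (Y \<omega>)) \<partial>M)"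
    using eq
  proof (intro nn_integral_cong_AE, eventually_elim)
    case (elim \<omega>)
    then show ?case by (cases "Y \<omega>") (auto simp: e2ennreal_ereal)
  qed
  with nn show integrable: "integrable M (\<lambda>\<omega>. real_of_ereal (Y \<omega>))"
    using pos' by (intro integrableI_nonneg) (auto simp: top.not_eq_extremum)
  show "expect M Y = ereal (\<integral>\<omega>. real_of_ereal (Y \<omega>) \<partial>M)"
    unfolding expect_def int nn_integral_eq_integral[OF integrable pos']
    using pos' by (simp add: enn2ereal_ennreal integral_nonneg_AE)
qed

text \<open>The majorant \<open>R\<close> will be a sum with signed terms; it is nonnegative almost
  everywhere because it dominates \<open>Y\<close>, so its two kinds of integral agree.\<close>

lemma expect_le_integral:
  assumes "AE \<omega> in M. 0 \<le> Y \<omega>" and le: "AE \<omega> in M. Y \<omega> \<le> ereal (R \<omega>)" and R: "integrable M R"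
  shows "expect M Y \<le> ereal (\<integral>\<omega>. R \<omega> \<partial>M)"
proof -
  have pos: "AE \<omega> in M. 0 \<le> R \<omega>"
    using assms(1,2)
  proof eventually_elim
    case (elim \<omega>)
    then have "0 \<le> ereal (R \<omega>)" by (rule order_trans)
    then show ?case by simp
  qed
  have "(\<integral>\<^sup>+\<omega>. e2ennreal (Y \<omega>) \<partial>M) \<le> (\<integral>\<^sup>+\<omega>. ennreal (R \<omega>) \<partial>M)"
    using le
  proof (intro nn_integral_mono_AE, eventually_elim)
    case (elim \<omega>)
    then show ?case by (metis e2ennreal_ereal e2ennreal_mono)
  qed
  also have "\<dots> = ennreal (\<integral>\<omega>. R \<omega> \<partial>M)"
    using R pos by (rule nn_integral_eq_integral)
  finally have "expect M Y \<le> enn2ereal (ennreal (\<integral>\<omega>. R \<omega> \<partial>M))"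
    unfolding expect_def by (simp add: less_eq_ennreal.rep_eq)
  also have "\<dots> = ereal (\<integral>\<omega>. R \<omega> \<partial>M)"
    using pos by (simp add: enn2ereal_ennreal integral_nonneg_AE)
  finally show ?thesis .
qed

lemma integrable_inner_of_norm_sq:
  fixes X Y :: "'w \<Rightarrow> 'e::euclidean_space"
  assumes [measurable]: "X \<in> borel_measurable M" "Y \<in> borel_measurable M"
    and "integrable M (\<lambda>\<omega>. (norm (X \<omega>))\<^sup>2)" "integrable M (\<lambda>\<omega>. (norm (Y \<omega>))\<^sup>2)"
  shows "integrable M (\<lambda>\<omega>. X \<omega> \<bullet> Y \<omega>)"
proof (rule Bochner_Integration.integrable_bound)
  show "integrable M (\<lambda>\<omega>. (norm (X \<omega>))\<^sup>2 + (norm (Y \<omega>))\<^sup>2)"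
    using assms(3,4) by (rule Bochner_Integration.integrable_add)
  have "norm (X \<omega> \<bullet> Y \<omega>) \<le> norm ((norm (X \<omega>))\<^sup>2 + (norm (Y \<omega>))\<^sup>2)" for \<omega>
  proof -
    have "norm (X \<omega> \<bullet> Y \<omega>) \<le> norm (X \<omega>) * norm (Y \<omega>)"
      by (simp add: Cauchy_Schwarz_ineq2)
    moreover have "0 \<le> (norm (X \<omega>) - norm (Y \<omega>))\<^sup>2" "0 \<le> norm (X \<omega>) * norm (Y \<omega>)" by simp_all
    ultimately show ?thesis by (simp add: power2_diff)
  qed
  then show "AE \<omega> in M. norm (X \<omega> \<bullet> Y \<omega>) \<le> norm ((norm (X \<omega>))\<^sup>2 + (norm (Y \<omega>))\<^sup>2)" by simp
qed simp

lemma integrable_norm_sq_add: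
  fixes X Y :: "'w \<Rightarrow> 'e::euclidean_space"
  assumes [measurable]: "X \<in> borel_measurable M" "Y \<in> borel_measurable M"
    and int: "integrable M (\<lambda>\<omega>. (norm (X \<omega>))\<^sup>2)" "integrable M (\<lambda>\<omega>. (norm (Y \<omega>))\<^sup>2)"
  shows "integrable M (\<lambda>\<omega>. (norm (X \<omega> + Y \<omega>))\<^sup>2)"
proof -
  have "(norm (X \<omega> + Y \<omega>))\<^sup>2 = (norm (X \<omega>))\<^sup>2 + 2 * (X \<omega> \<bullet> Y \<omega>) + (norm (Y \<omega>))\<^sup>2" for \<omega>
    by (simp add: power2_norm_eq_inner inner_add_left inner_add_right inner_commute)
  then show ?thesis
    using int integrable_inner_of_norm_sq[OF assms] by simp
qed

section \<open>Weighted geometric sums\<close>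

text \<open>Truncated form of the series with value \<open>(1 + q) / (1 - q)^3\<close> for
  \<open>q = 1 - \<rho>\<close>, multiplied by \<open>\<rho>^3\<close> to stay free of
  division.\<close>

lemma sum_geometric_squares:
  fixes \<rho> :: real
  shows "\<rho> ^ 3 * (\<Sum>k<n. (1 - \<rho>) ^ k * (real (Suc k))\<^sup>2)
    = 2 - \<rho> - (1 - \<rho>) ^ n * (\<rho>\<^sup>2 * (real n)\<^sup>2 + 2 * \<rho> * real n + 2 - \<rho>)"
proof (induction n)
  case (Suc n)
  define q where "q = (1 - \<rho>) ^ n"
  have "\<rho> ^ 3 * (\<Sum>k<Suc n. (1 - \<rho>) ^ k * (real (Suc k))\<^sup>2)
      = 2 - \<rho> - q * (\<rho>\<^sup>2 * (real n)\<^sup>2 + 2 * \<rho> * real n + 2 - \<rho>) + \<rho> ^ 3 * (q * (real n + 1)\<^sup>2)"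
    using Suc by (simp add: q_def distrib_left add.commute)
  also have "\<dots> = 2 - \<rho> - ((1 - \<rho>) * q) * (\<rho>\<^sup>2 * (real n + 1)\<^sup>2 + 2 * \<rho> * (real n + 1) + 2 - \<rho>)"
    by (simp add: algebra_simps power2_eq_square power3_eq_cube)
  finally show ?case by (simp add: q_def add.commute)
qed simp

text \<open>Reversing the sum orders the errors by age. The squared ages contribute at most
  \<open>2 / \<rho>^3\<close> and the constants at most \<open>1 / \<rho>\<close>, each times the
  outer factor \<open>\<rho>\<close>.\<close>

lemma sum_weighted_drift_bound:
  fixes \<rho> a b :: real
  assumes \<rho>: "0 < \<rho>" "\<rho> \<le> 1" and ab: "0 \<le> a" "0 \<le> b"
  shows "(\<Sum>i<n. (1 - \<rho>) ^ (n - Suc i) * (\<rho> * (a * (real i - real n)\<^sup>2 + b))) \<le> 2 * a / \<rho>\<^sup>2 + b"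
proof -
  \<comment> \<open>The time distance \<open>n - i\<close> exceeds the exponent by one, hence the
    shift to \<open>Suc\<close>.\<close>
  have "(\<Sum>i<n. (1 - \<rho>) ^ (n - Suc i) * (\<rho> * (a * (real i - real n)\<^sup>2 + b)))
      = (\<Sum>i<n. (1 - \<rho>) ^ (n - Suc i) * (\<rho> * (a * (real (Suc (n - Suc i)))\<^sup>2 + b)))"
  proof (intro sum.cong refl)
    fix i assume "i \<in> {..<n}"
    then have "(real i - real n)\<^sup>2 = (real (Suc (n - Suc i)))\<^sup>2"
      by (simp add: of_nat_diff Suc_diff_Suc power2_commute)
    then show "(1 - \<rho>) ^ (n - Suc i) * (\<rho> * (a * (real i - real n)\<^sup>2 + b))
        = (1 - \<rho>) ^ (n - Suc i) * (\<rho> * (a * (real (Suc (n - Suc i)))\<^sup>2 + b))" by simp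
  qed
  also have "\<dots> = (\<Sum>k<n. (1 - \<rho>) ^ k * (\<rho> * (a * (real (Suc k))\<^sup>2 + b)))"
    by (rule sum.nat_diff_reindex)
  also have "\<dots> = a * (\<rho> * (\<Sum>k<n. (1 - \<rho>) ^ k * (real (Suc k))\<^sup>2)) + b * (\<rho> * (\<Sum>k<n. (1 - \<rho>) ^ k))"
    by (simp only: distrib_left sum.distrib sum_distrib_left mult_ac)
  also have "\<dots> \<le> a * (2 / \<rho>\<^sup>2) + b * 1"
  proof (intro add_mono mult_left_mono ab)
    have "0 \<le> (1 - \<rho>) ^ n * (\<rho>\<^sup>2 * (real n)\<^sup>2 + 2 * \<rho> * real n + 2 - \<rho>)"
      using \<rho> by (intro mult_nonneg_nonneg) (auto intro!: add_nonneg_nonneg simp flip: add_diff_eq)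
    then have "\<rho> ^ 3 * (\<Sum>k<n. (1 - \<rho>) ^ k * (real (Suc k))\<^sup>2) \<le> 2"
      unfolding sum_geometric_squares using \<rho> by simp
    then show "\<rho> * (\<Sum>k<n. (1 - \<rho>) ^ k * (real (Suc k))\<^sup>2) \<le> 2 / \<rho>\<^sup>2"
      using \<rho> by (simp add: field_simps power2_eq_square power3_eq_cube)
    have "\<rho> * (\<Sum>k<n. (1 - \<rho>) ^ k) = 1 - (1 - \<rho>) ^ n"
      using one_diff_power_eq[of "1 - \<rho>" n] by simp
    then show "\<rho> * (\<Sum>k<n. (1 - \<rho>) ^ k) \<le> 1" using \<rho> by simp
  qed
  finally show ?thesis by (simp add: mult.commute)
qed

text \<open>With \<open>y = \<rho> * n\<close>, the power is at most \<open>exp (- y)\<close>, and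
  \<open>y^2\<close> is at most \<open>exp y\<close>.\<close>

lemma power_times_square_le_one:
  fixes \<rho> :: real
  assumes "0 \<le> \<rho>" "\<rho> \<le> 1"
  shows "(1 - \<rho>) ^ n * (\<rho> * real n)\<^sup>2 \<le> 1"
proof -
  define y where "y = \<rho> * real n"
  have y: "0 \<le> y" using assms by (simp add: y_def)
  \<comment> \<open>The right side exceeds \<open>y\<close> by
    \<open>((y / 2 - 1)^2 + 1) / 2\<close>; it is the quadratic Taylor polynomial of
    \<open>exp\<close> at \<open>y / 2\<close>.\<close>
  have "y \<le> 1 + y / 2 + (y / 2)\<^sup>2 / 2"
    using zero_le_power2[of "y / 2 - 1"] by (simp add: power2_eq_square field_simps)
  also have "\<dots> \<le> exp (y / 2)" using y by (intro exp_lower_Taylor_quadratic) simp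
  finally have "y\<^sup>2 \<le> exp (y / 2) ^ 2" using y by (intro power_mono)
  also have "\<dots> = exp y" by (simp add: power2_eq_square flip: exp_add)
  finally have "y\<^sup>2 \<le> exp y" .
  have "(1 - \<rho>) ^ n \<le> exp (- \<rho>) ^ n"
    using assms exp_ge_add_one_self[of "- \<rho>"] by (intro power_mono) auto
  also have "\<dots> = exp (- y)" by (simp add: y_def mult.commute flip: exp_of_nat_mult)
  finally have "(1 - \<rho>) ^ n * y\<^sup>2 \<le> exp (- y) * exp y"
    using \<open>y\<^sup>2 \<le> exp y\<close> by (intro mult_mono) auto
  then show ?thesis by (simp add: y_def flip: exp_add)
qed

text \<open>The sequence is the square of \<open>n * sqrt q ^ n\<close>, which tends to 0.\<close>

lemma tendsto_square_times_power_zero: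
  fixes q :: real
  assumes "0 \<le> q" "q < 1"
  shows "(\<lambda>n. (real n)\<^sup>2 * q ^ n) \<longlonglongrightarrow> 0"
proof -
  have "(\<lambda>n. real n * sqrt q ^ n) \<longlonglongrightarrow> 0"
    using assms by (intro powser_times_n_limit_0) simp
  then have "(\<lambda>n. (real n * sqrt q ^ n)\<^sup>2) \<longlonglongrightarrow> 0\<^sup>2" by (rule tendsto_power)
  moreover have "(real n * sqrt q ^ n)\<^sup>2 = (real n)\<^sup>2 * q ^ n" for n
    using assms(1) unfolding power_mult_distrib
    by (metis mult.commute power_mult real_sqrt_pow2)
  ultimately show ?thesis by simp
qed

section \<open>Consequences of the filtration\<close>

text \<open>In each coordinate the factor measurable at time \<open>i\<close> is pulled out of the
  conditional expectation, which vanishes. Square integrability makes the products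
  integrable.\<close>

lemma (in stochastic_framework) noise_orthogonal:
  assumes X: "X \<in> borel_measurable (\<F> i)" "integrable M (\<lambda>\<omega>. (norm (X \<omega>))\<^sup>2)"
    and z: "integrable M (\<lambda>\<omega>. (norm (z i \<omega>))\<^sup>2)"
  shows "(\<integral>\<omega>. z i \<omega> \<bullet> X \<omega> \<partial>M) = 0"
proof -
  interpret F: finite_measure_subalgebra M "\<F> i"
    using subalg by unfold_locales
  have [measurable]: "X \<in> borel_measurable M" "z i \<in> borel_measurable M"
    using measurable_from_subalg[OF subalg X(1)] measurable_from_subalg[OF subalg z_measurable] .
  have Xb: "(\<lambda>\<omega>. X \<omega> \<bullet> b) \<in> borel_measurable (\<F> i)" for b
    using X(1) by measurable
  \<comment> \<open>The vectors \<open>(Y \<bullet> b) b\<close> are used because their inner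
    products are exactly the products of coordinates.\<close>
  have sq: "integrable M (\<lambda>\<omega>. (norm ((Y \<omega> \<bullet> b) *\<^sub>R b))\<^sup>2)"
    if [measurable]: "Y \<in> borel_measurable M" and Y: "integrable M (\<lambda>\<omega>. (norm (Y \<omega>))\<^sup>2)"
      and b: "b \<in> Basis" for Y :: "'w \<Rightarrow> 'e" and b
  proof (rule Bochner_Integration.integrable_bound[OF Y])
    show "AE \<omega> in M. norm ((norm ((Y \<omega> \<bullet> b) *\<^sub>R b))\<^sup>2) \<le> norm ((norm (Y \<omega>))\<^sup>2)"
      using b by (intro AE_I2) (auto intro!: power_mono Basis_le_norm simp: abs_le_square_iff[symmetric])
  qed simp
  have int: "integrable M (\<lambda>\<omega>. (X \<omega> \<bullet> b) * (z i \<omega> \<bullet> b))" if b: "b \<in> Basis" for b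
    using integrable_inner_of_norm_sq[OF _ _ sq[OF _ X(2) b] sq[OF _ z b]] b
    by (simp add: mult.commute)
  have zero: "(\<integral>\<omega>. (X \<omega> \<bullet> b) * (z i \<omega> \<bullet> b) \<partial>M) = 0" if b: "b \<in> Basis" for b
  proof -
    have "AE \<omega> in M. real_cond_exp M (\<F> i) (\<lambda>\<omega>'. z i \<omega>' \<bullet> b) \<omega> = 0"
      using z_cond_exp[of i]
    proof eventually_elim
      case (elim \<omega>)
      have "vec_cond_exp M (\<F> i) (z i) \<omega> \<bullet> b = real_cond_exp M (\<F> i) (\<lambda>\<omega>'. z i \<omega>' \<bullet> b) \<omega>"
        unfolding vec_cond_exp_def using b by (rule inner_sum_left_Basis)
      with elim show ?case by simp
    qed
    then have "(\<integral>\<omega>. (X \<omega> \<bullet> b) * real_cond_exp M (\<F> i) (\<lambda>\<omega>'. z i \<omega>' \<bullet> b) \<omega> \<partial>M) = 0"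
      by (intro integral_eq_zero_AE) auto
    then show ?thesis
      using F.real_cond_exp_intg(2)[OF int[OF b] Xb] by simp
  qed
  have "(\<integral>\<omega>. z i \<omega> \<bullet> X \<omega> \<partial>M) = (\<integral>\<omega>. (\<Sum>b\<in>Basis. (X \<omega> \<bullet> b) * (z i \<omega> \<bullet> b)) \<partial>M)"
    by (intro Bochner_Integration.integral_cong refl) (subst euclidean_inner, simp add: mult.commute)
  also have "\<dots> = 0"
    using int zero by (simp add: Bochner_Integration.integral_sum)
  finally show ?thesis .
qed

text \<open>The preimage of an attained value is a nonempty event of the trivial sigma-algebra,
  hence the whole space.\<close>

lemma (in stochastic_framework) x_0_const:
  "\<exists>c. \<forall>\<omega>\<in>space M. x 0 \<omega> = c"
proof -
  obtain \<omega>0 where \<omega>0: "\<omega>0 \<in> space M" using not_empty by blast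
  have "x 0 -` {x 0 \<omega>0} \<inter> space (\<F> 0) \<in> sets (\<F> 0)"
    using x_adapted[of 0] by (rule measurable_sets) simp
  moreover have "space (\<F> 0) = space M"
    using subalg[of 0] by (simp add: subalgebra_def)
  ultimately have "x 0 -` {x 0 \<omega>0} \<inter> space M = space M"
    using \<omega>0 trivial_0 by auto
  then show ?thesis by (intro exI[of _ "x 0 \<omega>0"]) blast
qed

section \<open>Drifting equilibria\<close>

locale drifting_equilibria =
  problem_family M f r \<mu> L \<gamma> + averaged_prox_sgd M f r \<mu> \<gamma> "\<lambda>_. \<eta>" x xhat z
  + stochastic_framework M \<F> x xbar z
  for M :: "'w measure" and \<F> :: "nat \<Rightarrow> 'w measure"
    and f :: "('w, 'e::euclidean_space) loss" and r :: "('w, 'e) regularizer"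
    and x xhat xbar z :: "nat \<Rightarrow> 'w \<Rightarrow> 'e" and \<mu> L \<gamma> \<eta> :: real +
  fixes r_const :: "'w \<Rightarrow> 'e \<Rightarrow> ereal" and \<mu>_hat \<rho>_hat \<Delta> \<sigma> :: real
  assumes equilibria: "equilibria M f r xbar"
    and gap_measurable:
      "\<And>t. (\<lambda>\<omega>. gap f r xbar t \<omega> (x 0 \<omega>)) \<in> borel_measurable M"
    and drift_measurable: "\<And>i t. i < t \<Longrightarrow> grad_drift f i t \<in> borel_measurable M"
    and \<mu>_hat: "\<mu>_hat = \<mu> - 2 * \<gamma>"
    and \<rho>_hat: "\<rho>_hat = \<mu>_hat * \<eta> / (2 - \<mu> * \<eta>)"
    and \<eta>: "0 < \<eta>" "\<eta> \<le> 1 / (2 * L)"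
    and r_identical: "\<And>t \<omega>. \<omega> \<in> space M \<Longrightarrow> r t \<omega> = r_const \<omega>"
    and drift: "\<And>i t. i < t \<Longrightarrow>
      expect M (\<lambda>\<omega>. (grad_drift f i t \<omega>)\<^sup>2) \<le> ereal ((\<mu>_hat * \<Delta> * \<bar>real i - real t\<bar>)\<^sup>2)"
    and noise: "\<And>i t. i < t \<Longrightarrow> expect M (\<lambda>\<omega>. ereal ((norm (z i \<omega>))\<^sup>2)) \<le> ereal (\<sigma>\<^sup>2)"
    and uncorrelated: "\<And>i t. i < t \<Longrightarrow>
      integrable M (\<lambda>\<omega>. z i \<omega> \<bullet> xbar t \<omega>) \<and> (\<integral>\<omega>. z i \<omega> \<bullet> xbar t \<omega> \<partial>M) = 0"
begin

lemma sensitivity_bound: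
  assumes "\<omega> \<in> space M"
  shows "norm (grad (f t \<omega> a) u - grad (f t \<omega> b) u) \<le> \<gamma> * norm (a - b)"
proof (cases "a = b")
  case False
  have "ereal (norm (grad (f t \<omega> a) u - grad (f t \<omega> b) u) / norm (a - b)) \<le> sensitivity M f"
    unfolding sensitivity_def using assms False by (intro SUP_upper2[where i = "(\<omega>, t, u, a, b)"]) auto
  then show ?thesis
    using False by (simp add: gamma_eq field_simps)
qed simp

text \<open>The supremum defining \<open>\<gamma>\<close> contains a nonnegative quotient, since
  there are an outcome and two distinct points.\<close>

lemma gamma_nonneg: "0 \<le> \<gamma>"
proof -
  obtain \<omega> where \<omega>: "\<omega> \<in> space M" using not_empty by blast
  obtain b :: 'e where b: "b \<in> Basis" using nonempty_Basis by blast
  have "0 \<le> norm (grad (f 0 \<omega> b) 0 - grad (f 0 \<omega> 0) 0)" by simp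
  also have "\<dots> \<le> \<gamma>" using sensitivity_bound[OF \<omega>, of 0 b 0 0] b by simp
  finally show ?thesis .
qed

lemma mu_hat_pos: "0 < \<mu>_hat" and mu_hat_le: "\<mu>_hat \<le> \<mu>"
  using gamma_less gamma_nonneg by (auto simp: \<mu>_hat)

lemma step_le_half: "\<mu> * \<eta> \<le> 1 / 2"
proof -
  obtain \<omega> where "\<omega> \<in> space M" using not_empty by blast
  then have "\<mu> \<le> L" using strongly_convex_le_smooth[OF f_strongly_convex f_smooth] by blast
  then have "\<mu> * \<eta> \<le> L * \<eta>" using \<eta> by (intro mult_right_mono) auto
  also have "\<dots> \<le> 1 / 2" using \<eta> L_pos by (simp add: field_simps)
  finally show ?thesis .
qed

lemma rho_hat_pos: "0 < \<rho>_hat" and rho_hat_less_one: "\<rho>_hat < 1"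
proof -
  have "\<mu>_hat * \<eta> \<le> \<mu> * \<eta>" using mu_hat_le \<eta> by (intro mult_right_mono) auto
  then have "\<mu>_hat * \<eta> < 2 - \<mu> * \<eta>" using step_le_half by linarith
  then show "0 < \<rho>_hat" "\<rho>_hat < 1"
    using step_le_half mu_hat_pos \<eta> by (auto simp: \<rho>_hat divide_less_eq)
qed

text \<open>The 4 bounds \<open>(2 - \<mu> * \<eta>)^2\<close>; with the 2 of
  \<open>sum_weighted_drift_bound\<close> it makes the 8 of the final estimate.\<close>

lemma drift_over_rho_hat_sq: "\<mu>_hat * \<Delta>\<^sup>2 / \<rho>_hat\<^sup>2 \<le> 4 * \<Delta>\<^sup>2 / (\<mu>_hat * \<eta>\<^sup>2)"
proof -
  have "\<mu>_hat * \<Delta>\<^sup>2 / \<rho>_hat\<^sup>2 = \<Delta>\<^sup>2 / (\<mu>_hat * \<eta>\<^sup>2) * (2 - \<mu> * \<eta>)\<^sup>2"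
    unfolding \<rho>_hat using mu_hat_pos \<eta> step_le_half by (simp add: field_simps power2_eq_square)
  also have "\<dots> \<le> \<Delta>\<^sup>2 / (\<mu>_hat * \<eta>\<^sup>2) * 2\<^sup>2"
    using mu_hat_pos \<eta> step_le_half mu_pos by (intro mult_left_mono power_mono) auto
  finally show ?thesis by (simp add: mult.commute)
qed

lemma f_differentiable: "\<omega> \<in> space M \<Longrightarrow> f t \<omega> a differentiable (at u)"
  using f_smooth by (auto simp: lipschitz_smooth_def)

lemma r_const: "\<omega> \<in> space M \<Longrightarrow> proper_closed_convex (r_const \<omega>)"
  using r_proper_closed_convex[of \<omega> 0] r_identical by simp

text \<open>Since the regularizer does not change in time, at each outcome one effective domain
  serves the objectives of all times.\<close>

lemma
  assumes \<omega>: "\<omega> \<in> space M"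
  shows xbar_dom: "r_const \<omega> (xbar t \<omega>) \<noteq> \<infinity>"
    and xbar_min: "r_const \<omega> u \<noteq> \<infinity> \<Longrightarrow>
      f t \<omega> (xbar t \<omega>) (xbar t \<omega>) + real_of_ereal (r_const \<omega> (xbar t \<omega>))
        \<le> f t \<omega> (xbar t \<omega>) u + real_of_ereal (r_const \<omega> u)"
    and gap_xbar_eq: "gap f r xbar t \<omega> v = (if r_const \<omega> v = \<infinity> then \<infinity> else
      ereal (f t \<omega> (xbar t \<omega>) v + real_of_ereal (r_const \<omega> v)
        - (f t \<omega> (xbar t \<omega>) (xbar t \<omega>) + real_of_ereal (r_const \<omega> (xbar t \<omega>)))))"
proof -
  have min: "is_minimizer (psi f r t \<omega> (xbar t \<omega>)) (xbar t \<omega>)"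
    using equilibria \<omega> by (simp add: equilibria_def)
  then have min': "is_minimizer (\<lambda>u. ereal (f t \<omega> (xbar t \<omega>) u) + r_const \<omega> u) (xbar t \<omega>)"
    using r_identical[OF \<omega>] by (simp add: psi_def[abs_def])
  show "r_const \<omega> (xbar t \<omega>) \<noteq> \<infinity>"
    and "r_const \<omega> u \<noteq> \<infinity> \<Longrightarrow>
      f t \<omega> (xbar t \<omega>) (xbar t \<omega>) + real_of_ereal (r_const \<omega> (xbar t \<omega>))
        \<le> f t \<omega> (xbar t \<omega>) u + real_of_ereal (r_const \<omega> u)"
    using is_minimizer_real[OF r_const[OF \<omega>] min'] by auto
  show "gap f r xbar t \<omega> v = (if r_const \<omega> v = \<infinity> then \<infinity> else
      ereal (f t \<omega> (xbar t \<omega>) v + real_of_ereal (r_const \<omega> v)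
        - (f t \<omega> (xbar t \<omega>) (xbar t \<omega>) + real_of_ereal (r_const \<omega> (xbar t \<omega>)))))"
    using gap_eq[of r t \<omega> f xbar v, OF r_proper_closed_convex[OF \<omega>] min] r_identical[OF \<omega>] by simp
qed

lemma gap_nonneg: "\<omega> \<in> space M \<Longrightarrow> 0 \<le> gap f r xbar t \<omega> u"
  using xbar_min[of \<omega> u t] by (simp add: gap_xbar_eq)

lemma
  assumes \<omega>: "\<omega> \<in> space M"
  shows x_Suc_dom: "r_const \<omega> (x (Suc i) \<omega>) \<noteq> \<infinity>"
    and x_Suc_min: "r_const \<omega> u \<noteq> \<infinity> \<Longrightarrow>
      1 / (2 * \<eta>) * (norm (x (Suc i) \<omega> - (x i \<omega> - \<eta> *\<^sub>R (grad (f i \<omega> (x i \<omega>)) (x i \<omega>) - z i \<omega>))))\<^sup>2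
        + real_of_ereal (r_const \<omega> (x (Suc i) \<omega>))
      \<le> 1 / (2 * \<eta>) * (norm (u - (x i \<omega> - \<eta> *\<^sub>R (grad (f i \<omega> (x i \<omega>)) (x i \<omega>) - z i \<omega>))))\<^sup>2
        + real_of_ereal (r_const \<omega> u)"
proof -
  have "is_minimizer (\<lambda>u. ereal (1 / (2 * \<eta>) *
      (norm (u - (x i \<omega> - \<eta> *\<^sub>R (grad (f i \<omega> (x i \<omega>)) (x i \<omega>) - z i \<omega>))))\<^sup>2) + r_const \<omega> u) (x (Suc i) \<omega>)"
    using x_Suc[OF \<omega>, of i] unfolding is_prox_def r_identical[OF \<omega>] by (simp only: add.commute)
  from is_minimizer_real[OF r_const[OF \<omega>] this]
  show "r_const \<omega> (x (Suc i) \<omega>) \<noteq> \<infinity>"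
    and "r_const \<omega> u \<noteq> \<infinity> \<Longrightarrow>
      1 / (2 * \<eta>) * (norm (x (Suc i) \<omega> - (x i \<omega> - \<eta> *\<^sub>R (grad (f i \<omega> (x i \<omega>)) (x i \<omega>) - z i \<omega>))))\<^sup>2
        + real_of_ereal (r_const \<omega> (x (Suc i) \<omega>))
      \<le> 1 / (2 * \<eta>) * (norm (u - (x i \<omega> - \<eta> *\<^sub>R (grad (f i \<omega> (x i \<omega>)) (x i \<omega>) - z i \<omega>))))\<^sup>2
        + real_of_ereal (r_const \<omega> u)"
    by auto
qed

section \<open>Drift and noise moments\<close>

lemma grad_drift_bound:
  assumes "grad_drift f i t \<omega> = ereal G"
  shows "norm (grad (f i \<omega> a) u - grad (f t \<omega> a) u) \<le> G"
proof -
  have "ereal (norm (grad (f i \<omega> a) u - grad (f t \<omega> a) u)) \<le> grad_drift f i t \<omega>"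
    unfolding grad_drift_def by (intro SUP_upper2[where i = "(u, a)"]) auto
  then show ?thesis by (simp add: assms)
qed

lemma grad_drift_nonneg: "0 \<le> grad_drift f i t \<omega>"
proof -
  have "(0::ereal) \<le> ereal (norm (grad (f i \<omega> 0) 0 - grad (f t \<omega> 0) 0))" by simp
  also have "\<dots> \<le> grad_drift f i t \<omega>"
    unfolding grad_drift_def by (intro SUP_upper2[where i = "(0, 0)"]) auto
  finally show ?thesis .
qed

text \<open>Where the drift is infinite this has the default value 0; the finite second moment makes
  that a null event.\<close>

definition G :: "nat \<Rightarrow> nat \<Rightarrow> 'w \<Rightarrow> real" where
  "G i t \<omega> = real_of_ereal (grad_drift f i t \<omega>)"

text \<open>The moment bounds are assumed for \<open>i < t\<close>; the diagonal is wanted for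
  comparing time 0 with a horizon that may be 0.\<close>

lemma G_diag: "G t t = (\<lambda>_. 0)" and grad_drift_diag: "grad_drift f t t = (\<lambda>_. 0)"
proof -
  show "grad_drift f t t = (\<lambda>_. 0)"
    by (simp add: grad_drift_def fun_eq_iff case_prod_unfold zero_ereal_def[symmetric])
  then show "G t t = (\<lambda>_. 0)" by (simp add: G_def fun_eq_iff)
qed

lemma
  assumes "i \<le> t"
  shows AE_grad_drift: "AE \<omega> in M. grad_drift f i t \<omega> = ereal (G i t \<omega>)"
    and integrable_G: "integrable M (\<lambda>\<omega>. (G i t \<omega>)\<^sup>2)"
    and integral_G: "(\<integral>\<omega>. (G i t \<omega>)\<^sup>2 \<partial>M) \<le> (\<mu>_hat * \<Delta>)\<^sup>2 * (real i - real t)\<^sup>2"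
proof -
  have "(AE \<omega> in M. grad_drift f i t \<omega> = ereal (G i t \<omega>)) \<and> integrable M (\<lambda>\<omega>. (G i t \<omega>)\<^sup>2)
    \<and> (\<integral>\<omega>. (G i t \<omega>)\<^sup>2 \<partial>M) \<le> (\<mu>_hat * \<Delta>)\<^sup>2 * (real i - real t)\<^sup>2"
  proof (cases "i = t")
    case True
    then show ?thesis by (simp add: G_diag grad_drift_diag)
  next
    case False
    with assms have it: "i < t" by simp
    define Y where "Y \<omega> = (grad_drift f i t \<omega>)\<^sup>2" for \<omega>
    have [measurable]: "grad_drift f i t \<in> borel_measurable M" by (rule drift_measurable[OF it])
    have Y: "Y \<in> borel_measurable M" unfolding Y_def power2_eq_square by measurable
    have real: "real_of_ereal (Y \<omega>) = (G i t \<omega>)\<^sup>2" for \<omega>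
      by (simp add: Y_def G_def power2_eq_square)
    have le: "expect M Y \<le> ereal ((\<mu>_hat * \<Delta> * \<bar>real i - real t\<bar>)\<^sup>2)"
      using drift[OF it] by (simp add: Y_def[abs_def])
    then have "expect M Y \<noteq> \<infinity>" by auto
    from expect_finiteD[OF Y _ this]
    have 1: "AE \<omega> in M. Y \<omega> = ereal ((G i t \<omega>)\<^sup>2)" and 2: "integrable M (\<lambda>\<omega>. (G i t \<omega>)\<^sup>2)"
      and 3: "expect M Y = ereal (\<integral>\<omega>. (G i t \<omega>)\<^sup>2 \<partial>M)"
      unfolding real by (auto simp: Y_def power2_eq_square grad_drift_nonneg)
    have "AE \<omega> in M. grad_drift f i t \<omega> = ereal (G i t \<omega>)"
      using 1
    proof eventually_elim
      case (elim \<omega>)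
      then show ?case
        by (cases "grad_drift f i t \<omega>") (auto simp: G_def Y_def power2_eq_square)
    qed
    with 2 3 le show ?thesis by (simp add: power_mult_distrib)
  qed
  then show "AE \<omega> in M. grad_drift f i t \<omega> = ereal (G i t \<omega>)" "integrable M (\<lambda>\<omega>. (G i t \<omega>)\<^sup>2)"
    "(\<integral>\<omega>. (G i t \<omega>)\<^sup>2 \<partial>M) \<le> (\<mu>_hat * \<Delta>)\<^sup>2 * (real i - real t)\<^sup>2" by auto
qed

lemma iterates_measurable [measurable]:
  "x t \<in> borel_measurable M" "xbar t \<in> borel_measurable M" "z t \<in> borel_measurable M"
  using measurable_from_subalg[OF subalg x_adapted] measurable_from_subalg[OF subalg xbar_adapted]
    measurable_from_subalg[OF subalg z_measurable] by auto

lemma integrable_noise: "integrable M (\<lambda>\<omega>. (norm (z i \<omega>))\<^sup>2)"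
  and integral_noise: "(\<integral>\<omega>. (norm (z i \<omega>))\<^sup>2 \<partial>M) \<le> \<sigma>\<^sup>2"
proof -
  have le: "expect M (\<lambda>\<omega>. ereal ((norm (z i \<omega>))\<^sup>2)) \<le> ereal (\<sigma>\<^sup>2)"
    using noise[of i "Suc i"] by simp
  then have "expect M (\<lambda>\<omega>. ereal ((norm (z i \<omega>))\<^sup>2)) \<noteq> \<infinity>" by auto
  from expect_finiteD[OF _ _ this] le
  show "integrable M (\<lambda>\<omega>. (norm (z i \<omega>))\<^sup>2)" "(\<integral>\<omega>. (norm (z i \<omega>))\<^sup>2 \<partial>M) \<le> \<sigma>\<^sup>2"
    by auto
qed

section \<open>Pathwise bounds at a fixed horizon\<close>

text \<open>The error of \<open>prox_step\<close> when step \<open>i\<close> is measured against the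
  equilibrium of the horizon \<open>t\<close>.\<close>

definition step_error :: "nat \<Rightarrow> nat \<Rightarrow> 'w \<Rightarrow> real" where
  "step_error t i \<omega> = (G i t \<omega>)\<^sup>2 / \<mu>_hat + z i \<omega> \<bullet> (x i \<omega> - xbar t \<omega>) + \<eta> * (norm (z i \<omega>))\<^sup>2"

text \<open>First the decision moves from the equilibrium to the iterate at time \<open>t\<close>,
  at the cost of sensitivity; then time moves from \<open>t\<close> to \<open>i\<close> at a fixed
  decision, at the cost of drift.\<close>

lemma grad_estimate_error:
  assumes \<omega>: "\<omega> \<in> space M" and G: "grad_drift f i t \<omega> = ereal (G i t \<omega>)"
  shows "norm (grad (f t \<omega> (xbar t \<omega>)) (x i \<omega>) - (grad (f i \<omega> (x i \<omega>)) (x i \<omega>) - z i \<omega>) - z i \<omega>)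
    \<le> \<gamma> * norm (x i \<omega> - xbar t \<omega>) + G i t \<omega>"
proof -
  have "norm (grad (f t \<omega> (xbar t \<omega>)) (x i \<omega>) - (grad (f i \<omega> (x i \<omega>)) (x i \<omega>) - z i \<omega>) - z i \<omega>)
    = norm ((grad (f t \<omega> (xbar t \<omega>)) (x i \<omega>) - grad (f t \<omega> (x i \<omega>)) (x i \<omega>))
        - (grad (f i \<omega> (x i \<omega>)) (x i \<omega>) - grad (f t \<omega> (x i \<omega>)) (x i \<omega>)))"
    by (simp add: algebra_simps)
  also have "\<dots> \<le> norm (grad (f t \<omega> (xbar t \<omega>)) (x i \<omega>) - grad (f t \<omega> (x i \<omega>)) (x i \<omega>))
      + norm (grad (f i \<omega> (x i \<omega>)) (x i \<omega>) - grad (f t \<omega> (x i \<omega>)) (x i \<omega>))"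
    by (rule norm_triangle_ineq4)
  also have "\<dots> \<le> \<gamma> * norm (xbar t \<omega> - x i \<omega>) + G i t \<omega>"
    by (intro add_mono sensitivity_bound[OF \<omega>] grad_drift_bound[OF G])
  finally show ?thesis by (simp add: norm_minus_commute)
qed

text \<open>\<open>prox_step\<close> with the nonnegative gap of the new iterate dropped; it
  propagates square integrability.\<close>

lemma dist_step:
  assumes \<omega>: "\<omega> \<in> space M" and G: "grad_drift f i t \<omega> = ereal (G i t \<omega>)"
  shows "(1 / (2 * \<eta>) - \<mu> / 4) * (norm (x (Suc i) \<omega> - xbar t \<omega>))\<^sup>2
    \<le> (1 / (2 * \<eta>) - \<mu> / 2 + \<gamma> / 2) * (norm (x i \<omega> - xbar t \<omega>))\<^sup>2 + step_error t i \<omega>"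
  using prox_step[OF f_strongly_convex[OF \<omega>] f_smooth[OF \<omega>] effective_domain(1)[OF r_const[OF \<omega>]]
      _ _ _ \<eta> L_pos gamma_nonneg gamma_less grad_estimate_error[OF \<omega> G], of "x (Suc i) \<omega>"]
    x_Suc_min[OF \<omega>, of _ i] x_Suc_dom[OF \<omega>, of i] xbar_dom[OF \<omega>, of t]
    xbar_min[OF \<omega>, of "x (Suc i) \<omega>" t]
  unfolding step_error_def unfolding \<mu>_hat by simp

text \<open>A finite initial gap puts the starting point into the effective domain. The distance
  part of the final potential is nonnegative and dropped.\<close>

lemma gap_averaged_le:
  assumes \<omega>: "\<omega> \<in> space M" and G: "\<And>i. i < t \<Longrightarrow> grad_drift f i t \<omega> = ereal (G i t \<omega>)"
    and fin: "gap f r xbar t \<omega> (x 0 \<omega>) \<noteq> \<infinity>"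
  shows "gap f r xbar t \<omega> (xhat t \<omega>)
    \<le> ereal ((1 - \<rho>_hat) ^ t * (real_of_ereal (gap f r xbar t \<omega> (x 0 \<omega>))
          + \<mu>_hat / 4 * (norm (x 0 \<omega> - xbar t \<omega>))\<^sup>2)
        + (\<Sum>i<t. (1 - \<rho>_hat) ^ (t - Suc i) * (\<rho>_hat * step_error t i \<omega>)))"
proof -
  have x0: "r_const \<omega> (x 0 \<omega>) \<noteq> \<infinity>"
    using fin \<omega> by (auto simp: gap_xbar_eq)
  note bound = averaged_prox_gap_bound[of \<mu> "f t \<omega> (xbar t \<omega>)" L
      "{u. r_const \<omega> u \<noteq> \<infinity>}" "\<lambda>u. real_of_ereal (r_const \<omega> u)" "xbar t \<omega>" "\<lambda>i. x i \<omega>"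
      "\<lambda>i. xhat i \<omega>" \<eta> "\<lambda>i. grad (f i \<omega> (x i \<omega>)) (x i \<omega>) - z i \<omega>" \<rho>_hat \<gamma> t
      "\<lambda>i. z i \<omega>" "\<lambda>i. G i t \<omega>", folded \<mu>_hat, folded step_error_def]
  have xhat_dom: "r_const \<omega> (xhat t \<omega>) \<noteq> \<infinity>"
    and le: "f t \<omega> (xbar t \<omega>) (xhat t \<omega>) + real_of_ereal (r_const \<omega> (xhat t \<omega>))
      - (f t \<omega> (xbar t \<omega>) (xbar t \<omega>) + real_of_ereal (r_const \<omega> (xbar t \<omega>)))
      + \<mu>_hat / 4 * (norm (x t \<omega> - xbar t \<omega>))\<^sup>2
    \<le> (1 - \<rho>_hat) ^ t * (f t \<omega> (xbar t \<omega>) (x 0 \<omega>) + real_of_ereal (r_const \<omega> (x 0 \<omega>))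
      - (f t \<omega> (xbar t \<omega>) (xbar t \<omega>) + real_of_ereal (r_const \<omega> (xbar t \<omega>)))
      + \<mu>_hat / 4 * (norm (x 0 \<omega> - xbar t \<omega>))\<^sup>2)
      + (\<Sum>i<t. (1 - \<rho>_hat) ^ (t - Suc i) * (\<rho>_hat * step_error t i \<omega>))"
    using bound f_strongly_convex[OF \<omega>] f_smooth[OF \<omega>] effective_domain(1)[OF r_const[OF \<omega>]]
      xbar_dom[OF \<omega>] x0 xhat_0[OF \<omega>] x_Suc_dom[OF \<omega>] x_Suc_min[OF \<omega>]
      xhat_Suc[OF \<omega>, folded \<mu>_hat, folded \<rho>_hat] \<eta> L_pos gamma_nonneg gamma_less \<rho>_hat
      rho_hat_pos rho_hat_less_one grad_estimate_error[OF \<omega> G] by auto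
  moreover have "0 \<le> \<mu>_hat / 4 * (norm (x t \<omega> - xbar t \<omega>))\<^sup>2" using mu_hat_pos by simp
  ultimately show ?thesis
    using x0 by (simp add: gap_xbar_eq[OF \<omega>])
qed

text \<open>Quadratic growth bounds the distance term by half the gap \<open>D\<close>, and
  \<open>gap_transfer\<close> bounds \<open>D\<close>; the constants 3 and 12 are 3/2 times 2 and
  8.\<close>

lemma gap_initial_le:
  assumes \<omega>: "\<omega> \<in> space M" and G: "grad_drift f 0 t \<omega> = ereal (G 0 t \<omega>)"
    and gap0: "gap f r xbar 0 \<omega> (x 0 \<omega>) = ereal g0"
  shows "gap f r xbar t \<omega> (x 0 \<omega>) + ereal (\<mu>_hat / 4 * (norm (x 0 \<omega> - xbar t \<omega>))\<^sup>2)
    \<le> ereal (3 * g0 + 12 * (G 0 t \<omega>)\<^sup>2 / \<mu>)"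
proof -
  let ?\<phi> = "\<lambda>u. real_of_ereal (r_const \<omega> u)" and ?h = "\<lambda>t. f t \<omega> (xbar t \<omega>)"
  define D where "D = ?h t (x 0 \<omega>) + ?\<phi> (x 0 \<omega>) - (?h t (xbar t \<omega>) + ?\<phi> (xbar t \<omega>))"
  have x0: "r_const \<omega> (x 0 \<omega>) \<noteq> \<infinity>"
    using gap0 \<omega> by (auto simp: gap_xbar_eq)
  have grads: "norm (grad (?h 0) u - grad (?h t) u) \<le> G 0 t \<omega> + \<gamma> * norm (xbar 0 \<omega> - xbar t \<omega>)" for u
  proof -
    have "norm (grad (?h 0) u - grad (?h t) u)
        = norm ((grad (?h 0) u - grad (f t \<omega> (xbar 0 \<omega>)) u) + (grad (f t \<omega> (xbar 0 \<omega>)) u - grad (?h t) u))"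
      by simp
    also have "\<dots> \<le> norm (grad (?h 0) u - grad (f t \<omega> (xbar 0 \<omega>)) u)
        + norm (grad (f t \<omega> (xbar 0 \<omega>)) u - grad (?h t) u)"
      by (rule norm_triangle_ineq)
    also have "\<dots> \<le> G 0 t \<omega> + \<gamma> * norm (xbar 0 \<omega> - xbar t \<omega>)"
      by (intro add_mono sensitivity_bound[OF \<omega>] grad_drift_bound[OF G])
    finally show ?thesis .
  qed
  have "0 \<le> G 0 t \<omega>"
    unfolding G_def by (rule real_of_ereal_pos[OF grad_drift_nonneg])
  then have "D \<le> 2 * (?h 0 (x 0 \<omega>) + ?\<phi> (x 0 \<omega>) - (?h 0 (xbar 0 \<omega>) + ?\<phi> (xbar 0 \<omega>)))
      + 8 * (G 0 t \<omega>)\<^sup>2 / \<mu>"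
    unfolding D_def
    using gap_transfer[OF f_strongly_convex[OF \<omega>] f_differentiable[OF \<omega>]
        f_strongly_convex[OF \<omega>] f_differentiable[OF \<omega>] effective_domain(1)[OF r_const[OF \<omega>]]
        _ _ _ _ gamma_nonneg gamma_less _ grads]
      xbar_dom[OF \<omega>] xbar_min[OF \<omega>] x0 by simp
  also have "?h 0 (x 0 \<omega>) + ?\<phi> (x 0 \<omega>) - (?h 0 (xbar 0 \<omega>) + ?\<phi> (xbar 0 \<omega>)) = g0"
    using gap0 x0 by (simp add: gap_xbar_eq[OF \<omega>])
  finally have D: "D \<le> 2 * g0 + 8 * (G 0 t \<omega>)\<^sup>2 / \<mu>" .
  have "\<mu>_hat / 4 * (norm (x 0 \<omega> - xbar t \<omega>))\<^sup>2 \<le> \<mu> / 4 * (norm (x 0 \<omega> - xbar t \<omega>))\<^sup>2"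
    using mu_hat_le by (intro mult_right_mono) auto
  also have "\<mu> / 2 * (norm (x 0 \<omega> - xbar t \<omega>))\<^sup>2 \<le> D"
    using quadratic_growth[OF f_strongly_convex[OF \<omega>, of t "xbar t \<omega>"]
        effective_domain(1)[OF r_const[OF \<omega>]], of "xbar t \<omega>" "x 0 \<omega>"]
      xbar_dom[OF \<omega>] xbar_min[OF \<omega>] x0 by (simp add: D_def)
  then have "\<mu> / 4 * (norm (x 0 \<omega> - xbar t \<omega>))\<^sup>2 \<le> D / 2" by simp
  finally have "D + \<mu>_hat / 4 * (norm (x 0 \<omega> - xbar t \<omega>))\<^sup>2 \<le> 3 * g0 + 12 * (G 0 t \<omega>)\<^sup>2 / \<mu>"
    using D by simp
  then show ?thesis
    using x0 by (simp add: gap_xbar_eq[OF \<omega>] D_def)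
qed

section \<open>Mean of the step errors\<close>

text \<open>Induction along \<open>dist_step\<close>. Noise and current distance are square
  integrable, so their inner product is integrable before its mean is known.\<close>

lemma integrable_dist:
  assumes base: "integrable M (\<lambda>\<omega>. (norm (x 0 \<omega> - xbar t \<omega>))\<^sup>2)" and "i \<le> t"
  shows "integrable M (\<lambda>\<omega>. (norm (x i \<omega> - xbar t \<omega>))\<^sup>2)"
  using \<open>i \<le> t\<close>
proof (induction i)
  case (Suc i)
  define a b where "a = 1 / (2 * \<eta>) - \<mu> / 4" and "b = 1 / (2 * \<eta>) - \<mu> / 2 + \<gamma> / 2"
  have a: "0 < a" using step_le_half \<eta> by (simp add: a_def field_simps)
  have int: "integrable M (\<lambda>\<omega>. (norm (x i \<omega> - xbar t \<omega>))\<^sup>2)" using Suc by simp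
  then have "integrable M (\<lambda>\<omega>. z i \<omega> \<bullet> (x i \<omega> - xbar t \<omega>))"
    using integrable_noise by (intro integrable_inner_of_norm_sq) auto
  then have "integrable M (step_error t i)"
    unfolding step_error_def[abs_def] using integrable_G[of i t] integrable_noise Suc.prems by simp
  then have R: "integrable M (\<lambda>\<omega>. (b * (norm (x i \<omega> - xbar t \<omega>))\<^sup>2 + step_error t i \<omega>) / a)"
    using int by simp
  show ?case
  proof (rule Bochner_Integration.integrable_bound[OF R])
    show "AE \<omega> in M. norm ((norm (x (Suc i) \<omega> - xbar t \<omega>))\<^sup>2)
        \<le> norm ((b * (norm (x i \<omega> - xbar t \<omega>))\<^sup>2 + step_error t i \<omega>) / a)"
      using AE_grad_drift[OF Suc_leD[OF Suc.prems]] AE_space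
    proof eventually_elim
      case (elim \<omega>)
      then have "(norm (x (Suc i) \<omega> - xbar t \<omega>))\<^sup>2
          \<le> (b * (norm (x i \<omega> - xbar t \<omega>))\<^sup>2 + step_error t i \<omega>) / a"
        using dist_step[of \<omega> i t, folded a_def b_def]
        by (simp add: pos_le_divide_eq[OF a] mult.commute)
      from order_trans[OF this abs_ge_self] show ?case by simp
    qed
  qed simp
qed (rule base)

text \<open>The noise is orthogonal to the adapted iterate. The equilibrium of the later time
  \<open>t\<close> may depend on that noise, so its inner product vanishes by the correlation
  assumption instead.\<close>

lemma
  assumes base: "integrable M (\<lambda>\<omega>. (norm (x 0 \<omega> - xbar t \<omega>))\<^sup>2)" and it: "i < t"
  shows integrable_step_error: "integrable M (step_error t i)"
    and integral_step_error:
      "(\<integral>\<omega>. step_error t i \<omega> \<partial>M) \<le> \<mu>_hat * \<Delta>\<^sup>2 * (real i - real t)\<^sup>2 + \<eta> * \<sigma>\<^sup>2"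
proof -
  obtain c where c: "\<forall>\<omega>\<in>space M. x 0 \<omega> = c" using x_0_const ..
  have dist: "integrable M (\<lambda>\<omega>. (norm (x i \<omega> - xbar t \<omega>))\<^sup>2)"
    using it by (intro integrable_dist[OF base]) simp
  \<comment> \<open>Orthogonality needs the iterate itself in L2, not just its distance to the
    equilibrium; the constant start anchors the equilibrium, and this in turn the iterate.\<close>
  have "integrable M (\<lambda>\<omega>. (norm (c + (xbar t \<omega> - x 0 \<omega>)))\<^sup>2)"
    using base by (intro integrable_norm_sq_add) (auto simp: norm_minus_commute)
  then have "integrable M (\<lambda>\<omega>. (norm (xbar t \<omega>))\<^sup>2)"
    by (rule Bochner_Integration.integrable_cong[THEN iffD1, rotated 2]) (simp_all add: c)
  then have "integrable M (\<lambda>\<omega>. (norm ((x i \<omega> - xbar t \<omega>) + xbar t \<omega>))\<^sup>2)"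
    using dist by (intro integrable_norm_sq_add) auto
  then have x_sq: "integrable M (\<lambda>\<omega>. (norm (x i \<omega>))\<^sup>2)" by simp
  have zx: "integrable M (\<lambda>\<omega>. z i \<omega> \<bullet> x i \<omega>)"
    using integrable_noise x_sq by (intro integrable_inner_of_norm_sq) auto
  note int = integrable_G[OF less_imp_le[OF it]] zx uncorrelated[OF it] integrable_noise[of i]
  show "integrable M (step_error t i)"
    unfolding step_error_def[abs_def] inner_diff_right using int by auto
  have "(\<integral>\<omega>. step_error t i \<omega> \<partial>M) = (\<integral>\<omega>. (G i t \<omega>)\<^sup>2 \<partial>M) / \<mu>_hat
      + ((\<integral>\<omega>. z i \<omega> \<bullet> x i \<omega> \<partial>M) - (\<integral>\<omega>. z i \<omega> \<bullet> xbar t \<omega> \<partial>M)) + \<eta> * (\<integral>\<omega>. (norm (z i \<omega>))\<^sup>2 \<partial>M)"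
    unfolding step_error_def inner_diff_right using int by simp
  also have "\<dots> = (\<integral>\<omega>. (G i t \<omega>)\<^sup>2 \<partial>M) / \<mu>_hat + \<eta> * (\<integral>\<omega>. (norm (z i \<omega>))\<^sup>2 \<partial>M)"
    using noise_orthogonal[OF x_adapted x_sq integrable_noise] uncorrelated[OF it] by simp
  also have "\<dots> \<le> (\<mu>_hat * \<Delta>)\<^sup>2 * (real i - real t)\<^sup>2 / \<mu>_hat + \<eta> * \<sigma>\<^sup>2"
    using integral_G[OF less_imp_le[OF it]] integral_noise[of i] mu_hat_pos \<eta>
    by (intro add_mono divide_right_mono mult_left_mono) auto
  finally show "(\<integral>\<omega>. step_error t i \<omega> \<partial>M) \<le> \<mu>_hat * \<Delta>\<^sup>2 * (real i - real t)\<^sup>2 + \<eta> * \<sigma>\<^sup>2"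
    using mu_hat_pos by (simp add: power2_eq_square mult_ac)
qed

section \<open>Bounds in expectation\<close>

definition initial_energy :: "nat \<Rightarrow> ereal" where
  "initial_energy t = expect M (\<lambda>\<omega>. gap f r xbar t \<omega> (x 0 \<omega>)
     + ereal (\<mu>_hat / 4 * (norm (x 0 \<omega> - xbar t \<omega>))\<^sup>2))"

text \<open>Finite initial energy starts the integrability induction; the pathwise bound is then
  integrated term by term and the mean errors are summed.\<close>

lemma expected_gap_le:
  "expect M (\<lambda>\<omega>. gap f r xbar t \<omega> (xhat t \<omega>))
    \<le> ereal ((1 - \<rho>_hat) ^ t) * initial_energy t
      + ereal (\<eta> * \<sigma>\<^sup>2 + 8 * \<Delta>\<^sup>2 / (\<mu>_hat * \<eta>\<^sup>2))"
proof (cases "initial_energy t = \<infinity>")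
  case True
  \<comment> \<open>Strictness matters: \<open>0 * \<infinity>\<close> is 0 in \<open>ereal\<close>,
    but here the factor is positive and the right side infinite.\<close>
  then show ?thesis using rho_hat_less_one by simp
next
  case False
  define g E where "g \<omega> = gap f r xbar t \<omega> (x 0 \<omega>)"
    and "E \<omega> = g \<omega> + ereal (\<mu>_hat / 4 * (norm (x 0 \<omega> - xbar t \<omega>))\<^sup>2)" for \<omega>
  define e where "e \<omega> = real_of_ereal (E \<omega>)" for \<omega>
  have [measurable]: "g \<in> borel_measurable M" unfolding g_def by (rule gap_measurable)
  have E_meas: "E \<in> borel_measurable M" unfolding E_def by measurable
  have g_nonneg: "0 \<le> g \<omega>" if "\<omega> \<in> space M" for \<omega>
    using gap_nonneg[OF that] by (simp add: g_def)
  have E_nonneg: "AE \<omega> in M. 0 \<le> E \<omega>"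
    using g_nonneg mu_hat_pos by (auto simp: E_def)
  have "expect M E \<noteq> \<infinity>" using False by (simp add: initial_energy_def E_def[abs_def] g_def)
  note E_fin = expect_finiteD[OF E_meas E_nonneg this, folded e_def]
  have energy: "initial_energy t = ereal (\<integral>\<omega>. e \<omega> \<partial>M)"
    using E_fin(3) by (simp add: initial_energy_def E_def[abs_def] g_def)
  \<comment> \<open>Both summands are nonnegative, so finiteness of the sum passes to the gap and
    lets \<open>e\<close> dominate the squared distance.\<close>
  have split: "AE \<omega> in M. g \<omega> \<noteq> \<infinity> \<and> 0 \<le> real_of_ereal (g \<omega>) \<and>
      e \<omega> = real_of_ereal (g \<omega>) + \<mu>_hat / 4 * (norm (x 0 \<omega> - xbar t \<omega>))\<^sup>2"
    using E_fin(1) AE_space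
  proof eventually_elim
    case (elim \<omega>)
    then show ?case using g_nonneg[of \<omega>] by (cases "g \<omega>") (auto simp: E_def e_def)
  qed
  have base: "integrable M (\<lambda>\<omega>. (norm (x 0 \<omega> - xbar t \<omega>))\<^sup>2)"
  proof (rule Bochner_Integration.integrable_bound)
    show "integrable M (\<lambda>\<omega>. e \<omega> / (\<mu>_hat / 4))" using E_fin(2) by simp
    show "AE \<omega> in M. norm ((norm (x 0 \<omega> - xbar t \<omega>))\<^sup>2) \<le> norm (e \<omega> / (\<mu>_hat / 4))"
      using split
    proof eventually_elim
      case (elim \<omega>)
      then have "(norm (x 0 \<omega> - xbar t \<omega>))\<^sup>2 \<le> e \<omega> / (\<mu>_hat / 4)"
        using mu_hat_pos by (simp add: field_simps)
      from order_trans[OF this abs_ge_self] show ?case by simp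
    qed
  qed simp
  have "AE \<omega> in M. \<forall>i<t. grad_drift f i t \<omega> = ereal (G i t \<omega>)"
    using AE_grad_drift by (auto simp: AE_all_countable)
  then have le: "AE \<omega> in M. gap f r xbar t \<omega> (xhat t \<omega>) \<le> ereal ((1 - \<rho>_hat) ^ t * e \<omega>
      + (\<Sum>i<t. (1 - \<rho>_hat) ^ (t - Suc i) * (\<rho>_hat * step_error t i \<omega>)))"
    using split AE_space
  proof eventually_elim
    case (elim \<omega>)
    then show ?case using gap_averaged_le[of \<omega> t] by (simp add: g_def)
  qed
  have int: "integrable M (\<lambda>\<omega>. (1 - \<rho>_hat) ^ (t - Suc i) * (\<rho>_hat * step_error t i \<omega>))"
    if "i < t" for i
    using integrable_step_error[OF base that] by simp
  have "expect M (\<lambda>\<omega>. gap f r xbar t \<omega> (xhat t \<omega>))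
      \<le> ereal (\<integral>\<omega>. (1 - \<rho>_hat) ^ t * e \<omega>
      + (\<Sum>i<t. (1 - \<rho>_hat) ^ (t - Suc i) * (\<rho>_hat * step_error t i \<omega>)) \<partial>M)"
    using le gap_nonneg E_fin(2) int
    by (intro expect_le_integral) (auto intro!: Bochner_Integration.integrable_sum)
  also have "(\<integral>\<omega>. (1 - \<rho>_hat) ^ t * e \<omega>
      + (\<Sum>i<t. (1 - \<rho>_hat) ^ (t - Suc i) * (\<rho>_hat * step_error t i \<omega>)) \<partial>M)
      = (1 - \<rho>_hat) ^ t * (\<integral>\<omega>. e \<omega> \<partial>M)
      + (\<Sum>i<t. (1 - \<rho>_hat) ^ (t - Suc i) * (\<rho>_hat * (\<integral>\<omega>. step_error t i \<omega> \<partial>M)))"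
    using E_fin(2) int
    by (subst Bochner_Integration.integral_add)
      (auto intro!: Bochner_Integration.integrable_sum simp: Bochner_Integration.integral_sum
        simp del: integrable_mult_left_iff integrable_mult_right_iff)
  also have "(\<Sum>i<t. (1 - \<rho>_hat) ^ (t - Suc i) * (\<rho>_hat * (\<integral>\<omega>. step_error t i \<omega> \<partial>M)))
      \<le> (\<Sum>i<t. (1 - \<rho>_hat) ^ (t - Suc i) *
          (\<rho>_hat * (\<mu>_hat * \<Delta>\<^sup>2 * (real i - real t)\<^sup>2 + \<eta> * \<sigma>\<^sup>2)))"
    using integral_step_error[OF base] rho_hat_pos rho_hat_less_one
    by (intro sum_mono mult_left_mono) auto
  also have "\<dots> \<le> 2 * (\<mu>_hat * \<Delta>\<^sup>2) / \<rho>_hat\<^sup>2 + \<eta> * \<sigma>\<^sup>2"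
    using rho_hat_pos rho_hat_less_one mu_hat_pos \<eta> by (intro sum_weighted_drift_bound) auto
  also have "\<dots> \<le> \<eta> * \<sigma>\<^sup>2 + 8 * \<Delta>\<^sup>2 / (\<mu>_hat * \<eta>\<^sup>2)"
    using drift_over_rho_hat_sq by simp
  finally show ?thesis by (simp add: energy)
qed

text \<open>The squared drift from 0 to \<open>t\<close> has mean at most
  \<open>(\<mu>_hat * \<Delta> * t)^2\<close>; one factor \<open>\<mu>_hat \<le> \<mu>\<close>
  cancels the \<open>1 / \<mu>\<close> of \<open>gap_initial_le\<close>.\<close>

lemma initial_energy_le:
  assumes gap0: "\<And>\<omega>. \<omega> \<in> space M \<Longrightarrow> gap f r xbar 0 \<omega> (x 0 \<omega>) = ereal g0"
  shows "initial_energy t \<le> ereal (3 * g0 + 12 * \<mu>_hat * \<Delta>\<^sup>2 * (real t)\<^sup>2)"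
proof -
  have "AE \<omega> in M. gap f r xbar t \<omega> (x 0 \<omega>) + ereal (\<mu>_hat / 4 * (norm (x 0 \<omega> - xbar t \<omega>))\<^sup>2)
      \<le> ereal (3 * g0 + 12 * (G 0 t \<omega>)\<^sup>2 / \<mu>)"
    using AE_grad_drift[OF le0] AE_space by eventually_elim (intro gap_initial_le gap0)
  then have "initial_energy t \<le> ereal (\<integral>\<omega>. 3 * g0 + 12 * (G 0 t \<omega>)\<^sup>2 / \<mu> \<partial>M)"
    unfolding initial_energy_def using gap_nonneg mu_hat_pos integrable_G[OF le0]
    by (intro expect_le_integral) auto
  also have "(\<integral>\<omega>. 3 * g0 + 12 * (G 0 t \<omega>)\<^sup>2 / \<mu> \<partial>M) = 3 * g0 + 12 * (\<integral>\<omega>. (G 0 t \<omega>)\<^sup>2 \<partial>M) / \<mu>"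
    using integrable_G[OF le0] by (simp add: prob_space)
  also have "\<dots> \<le> 3 * g0 + 12 * (\<mu>_hat * \<mu>_hat * \<Delta>\<^sup>2 * (real t)\<^sup>2) / \<mu>"
    using integral_G[of 0 t] mu_pos by (simp add: divide_right_mono power2_eq_square mult_ac)
  also have "\<mu>_hat * \<mu>_hat * \<Delta>\<^sup>2 * (real t)\<^sup>2 \<le> \<mu> * \<mu>_hat * \<Delta>\<^sup>2 * (real t)\<^sup>2"
    using mu_hat_le mu_hat_pos by (intro mult_right_mono) auto
  finally show ?thesis
    using mu_pos by (simp add: divide_right_mono mult.assoc)
qed

lemma expected_gap_le_initial_gap:
  assumes gap0: "\<And>\<omega>. \<omega> \<in> space M \<Longrightarrow> gap f r xbar 0 \<omega> (x 0 \<omega>) = ereal g0"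
  shows "expect M (\<lambda>\<omega>. gap f r xbar t \<omega> (xhat t \<omega>))
    \<le> ereal ((1 - \<rho>_hat) ^ t * (3 * g0 + 12 * \<mu>_hat * \<Delta>\<^sup>2 * (real t)\<^sup>2)
      + (\<eta> * \<sigma>\<^sup>2 + 8 * \<Delta>\<^sup>2 / (\<mu>_hat * \<eta>\<^sup>2)))"
proof -
  have "ereal ((1 - \<rho>_hat) ^ t) * initial_energy t
      \<le> ereal ((1 - \<rho>_hat) ^ t) * ereal (3 * g0 + 12 * \<mu>_hat * \<Delta>\<^sup>2 * (real t)\<^sup>2)"
    using rho_hat_less_one by (intro ereal_mult_left_mono initial_energy_le gap0) auto
  from order_trans[OF expected_gap_le add_right_mono[OF this]] show ?thesis by simp
qed

lemma initial_gap_nonneg: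
  assumes "\<And>\<omega>. \<omega> \<in> space M \<Longrightarrow> gap f r xbar 0 \<omega> (x 0 \<omega>) = g0"
  shows "0 \<le> g0"
proof -
  obtain \<omega> where "\<omega> \<in> space M" using not_empty by blast
  then show ?thesis using assms gap_nonneg by metis
qed

text \<open>The quadratic growth of the initial energy in \<open>t\<close> is paid for by the power:
  \<open>power_times_square_le_one\<close> turns it into a multiple of the stationary drift
  term.\<close>

lemma expected_gap_order:
  assumes gap0: "\<And>\<omega>. \<omega> \<in> space M \<Longrightarrow> gap f r xbar 0 \<omega> (x 0 \<omega>) = gap_0"
  shows "expect M (\<lambda>\<omega>. gap f r xbar t \<omega> (xhat t \<omega>))
    \<le> ereal absolute_constant * (ereal ((1 - \<rho>_hat) ^ t) * gap_0
        + ereal (\<eta> * \<sigma>\<^sup>2 + \<Delta>\<^sup>2 / (\<mu>_hat * \<eta>\<^sup>2)))"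
proof (cases gap_0)
  case (real g0)
  define q B where "q = (1 - \<rho>_hat) ^ t" and "B = \<Delta>\<^sup>2 / (\<mu>_hat * \<eta>\<^sup>2)"
  have g0: "0 \<le> g0" using initial_gap_nonneg[OF gap0] real by simp
  have q: "0 \<le> q" using rho_hat_less_one by (simp add: q_def)
  have B: "0 \<le> B" using mu_hat_pos by (simp add: B_def)
  have "q * (\<mu>_hat * \<Delta>\<^sup>2 * (real t)\<^sup>2) = \<mu>_hat * \<Delta>\<^sup>2 / \<rho>_hat\<^sup>2 * (q * (\<rho>_hat * real t)\<^sup>2)"
    using rho_hat_pos by (simp add: power_mult_distrib)
  also have "\<dots> \<le> \<mu>_hat * \<Delta>\<^sup>2 / \<rho>_hat\<^sup>2 * 1"
    unfolding q_def using rho_hat_pos rho_hat_less_one mu_hat_pos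
    by (intro mult_left_mono power_times_square_le_one) auto
  also have "\<dots> \<le> 4 * B" using drift_over_rho_hat_sq by (simp add: B_def)
  finally have "q * (3 * g0 + 12 * \<mu>_hat * \<Delta>\<^sup>2 * (real t)\<^sup>2) \<le> 3 * (q * g0) + 48 * B"
    by (simp add: algebra_simps)
  moreover have "0 \<le> q * g0" "0 \<le> \<eta> * \<sigma>\<^sup>2" using q g0 \<eta> by simp_all
  \<comment> \<open>The drift coefficients add up to 48 + 8 = 56, below the chosen constant.\<close>
  moreover have "X + (s + 8 * B) \<le> absolute_constant * (a + (s + B))"
    if "X \<le> 3 * a + 48 * B" "0 \<le> a" "0 \<le> s" for X a s :: real
    using that B by (simp add: absolute_constant_def)
  ultimately have "q * (3 * g0 + 12 * \<mu>_hat * \<Delta>\<^sup>2 * (real t)\<^sup>2) + (\<eta> * \<sigma>\<^sup>2 + 8 * B)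
      \<le> absolute_constant * (q * g0 + (\<eta> * \<sigma>\<^sup>2 + B))"
    by blast
  then show ?thesis
    using order_trans[OF expected_gap_le_initial_gap[OF gap0[unfolded real], of t]]
    by (simp add: real q_def B_def)
next
  case PInf
  \<comment> \<open>Both factors in front of the infinite gap are positive, so the right side is
    infinite.\<close>
  then show ?thesis using rho_hat_less_one by (simp add: absolute_constant_def)
next
  case MInf
  then show ?thesis using initial_gap_nonneg[OF gap0] by simp
qed

text \<open>For fixed parameters the power beats \<open>t^2\<close>, so the whole transient part
  vanishes and the constant 8 survives.\<close>

lemma limsup_expected_gap:
  assumes gap0: "\<And>\<omega>. \<omega> \<in> space M \<Longrightarrow> gap f r xbar 0 \<omega> (x 0 \<omega>) = gap_0" and fin: "gap_0 < \<infinity>"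
  shows "limsup (\<lambda>t. expect M (\<lambda>\<omega>. gap f r xbar t \<omega> (xhat t \<omega>)))
    \<le> ereal (\<eta> * \<sigma>\<^sup>2 + 8 * \<Delta>\<^sup>2 / (\<mu>_hat * \<eta>\<^sup>2))"
proof -
  obtain g0 where g0: "gap_0 = ereal g0"
    using fin initial_gap_nonneg[OF gap0] by (cases gap_0) auto
  define K where "K = \<eta> * \<sigma>\<^sup>2 + 8 * \<Delta>\<^sup>2 / (\<mu>_hat * \<eta>\<^sup>2)"
  define b where "b t = 3 * g0 * (1 - \<rho>_hat) ^ t
      + 12 * \<mu>_hat * \<Delta>\<^sup>2 * ((real t)\<^sup>2 * (1 - \<rho>_hat) ^ t) + K" for t
  have "b \<longlonglongrightarrow> 3 * g0 * 0 + 12 * \<mu>_hat * \<Delta>\<^sup>2 * 0 + K"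
    unfolding b_def using rho_hat_pos rho_hat_less_one
    by (intro tendsto_intros LIMSEQ_realpow_zero tendsto_square_times_power_zero) auto
  then have "limsup (\<lambda>t. ereal (b t)) = ereal K"
    by (intro lim_imp_Limsup) auto
  moreover have "expect M (\<lambda>\<omega>. gap f r xbar t \<omega> (xhat t \<omega>)) \<le> ereal (b t)" for t
    using expected_gap_le_initial_gap[OF gap0[unfolded g0], of t]
    by (simp add: b_def K_def algebra_simps)
  ultimately show ?thesis
    using Limsup_mono[of "\<lambda>t. expect M (\<lambda>\<omega>. gap f r xbar t \<omega> (xhat t \<omega>))" "\<lambda>t. ereal (b t)" sequentially]
    by (simp add: K_def)
qed

end

theorem corollary34:
  fixes M :: "'w measure" and \<F> :: "nat \<Rightarrow> 'w measure"
    and f :: "('w, 'e::euclidean_space) loss" and r :: "('w, 'e) regularizer"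
    and r_const :: "'w \<Rightarrow> 'e \<Rightarrow> ereal"
    and x xhat xbar z :: "nat \<Rightarrow> 'w \<Rightarrow> 'e"
    and \<mu> L \<gamma> \<mu>_hat \<eta> \<rho>_hat \<Delta> \<sigma> :: real and gap_0 :: ereal
  assumes problem: "problem_family M f r \<mu> L \<gamma>"
    and equilibria: "equilibria M f r xbar"
    and algorithm: "averaged_prox_sgd M f r \<mu> \<gamma> (\<lambda>_. \<eta>) x xhat z"
    and framework: "stochastic_framework M \<F> x xbar z"
    and initial_gap: "\<And>\<omega>. \<omega> \<in> space M \<Longrightarrow> gap f r xbar 0 \<omega> (x 0 \<omega>) = gap_0"
    and gap_measurable:
      "\<And>t. (\<lambda>\<omega>. gap f r xbar t \<omega> (xhat t \<omega>)) \<in> borel_measurable M"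
      "\<And>t. (\<lambda>\<omega>. gap f r xbar t \<omega> (x 0 \<omega>)) \<in> borel_measurable M"
    and drift_measurable: "\<And>i t. i < t \<Longrightarrow> grad_drift f i t \<in> borel_measurable M"
    and \<mu>_hat: "\<mu>_hat = \<mu> - 2 * \<gamma>"
    and \<rho>_hat: "\<rho>_hat = \<mu>_hat * \<eta> / (2 - \<mu> * \<eta>)"
    and \<eta>: "0 < \<eta>" "\<eta> \<le> 1 / (2 * L)"
    and r_identical: "\<And>t \<omega>. \<omega> \<in> space M \<Longrightarrow> r t \<omega> = r_const \<omega>"
    and constants: "\<Delta> > 0" "\<sigma> > 0"
    and drift: "\<And>i t. i < t \<Longrightarrow>
      expect M (\<lambda>\<omega>. (grad_drift f i t \<omega>)\<^sup>2) \<le> ereal ((\<mu>_hat * \<Delta> * \<bar>real i - real t\<bar>)\<^sup>2)"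
    and noise: "\<And>i t. i < t \<Longrightarrow> expect M (\<lambda>\<omega>. ereal ((norm (z i \<omega>))\<^sup>2)) \<le> ereal (\<sigma>\<^sup>2)"
    and uncorrelated: "\<And>i t. i < t \<Longrightarrow>
      integrable M (\<lambda>\<omega>. z i \<omega> \<bullet> xbar t \<omega>) \<and> (\<integral>\<omega>. z i \<omega> \<bullet> xbar t \<omega> \<partial>M) = 0"
  shows "(\<forall>t. expect M (\<lambda>\<omega>. gap f r xbar t \<omega> (xhat t \<omega>))
            \<le> ereal ((1 - \<rho>_hat) ^ t)
                * expect M (\<lambda>\<omega>. gap f r xbar t \<omega> (x 0 \<omega>)
                    + ereal (\<mu>_hat / 4 * (norm (x 0 \<omega> - xbar t \<omega>))\<^sup>2))
              + ereal (\<eta> * \<sigma>\<^sup>2 + 8 * \<Delta>\<^sup>2 / (\<mu>_hat * \<eta>\<^sup>2)))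
       \<and> (\<forall>t. expect M (\<lambda>\<omega>. gap f r xbar t \<omega> (xhat t \<omega>))
            \<le> ereal absolute_constant
                * (ereal ((1 - \<rho>_hat) ^ t) * gap_0
                   + ereal (\<eta> * \<sigma>\<^sup>2 + \<Delta>\<^sup>2 / (\<mu>_hat * \<eta>\<^sup>2))))
       \<and> (gap_0 < \<infinity> \<longrightarrow>
            limsup (\<lambda>t. expect M (\<lambda>\<omega>. gap f r xbar t \<omega> (xhat t \<omega>)))
              \<le> ereal (\<eta> * \<sigma>\<^sup>2 + 8 * \<Delta>\<^sup>2 / (\<mu>_hat * \<eta>\<^sup>2)))"
proof -
  interpret drifting_equilibria M \<F> f r x xhat xbar z \<mu> L \<gamma> \<eta> r_const \<mu>_hat \<rho>_hat \<Delta> \<sigma>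
    unfolding drifting_equilibria_def drifting_equilibria_axioms_def
    using assms by blast
  show ?thesis
    using expected_gap_le[unfolded initial_energy_def] expected_gap_order[OF initial_gap]
      limsup_expected_gap[OF initial_gap] by blast
qed

end
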